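(* Let $H$ be a graph with vertex set $\{v_1,\dots,v_k\}$, and let $G_1,\dots,G_k$ be arbitrary graphs. Let $G_i$ have $n_i$ vertices, adjacency matrix $A_i$ and degree matrix $D_i$. Let $G=\bigvee_H\{G_1,\dots,G_k\}$ be the $H$-join and $n=\sum_i n_i$. Let $\alpha,\beta,\gamma,\delta\in\mathbb{R}$ with $\alpha\neq0$. Let $U(G)=\alpha A(G)+\beta I_n+\gamma J_n+\delta D(G)$ and $U_i=\alpha A_i+\beta I_{n_i}+\gamma J_{n_i}+\delta D_i$. Let $\phi_i(\lambda)=\det(\lambda I_{n_i}-U_i)$ and $\Gamma_i(\lambda)=\mathbf{1}_{n_i}^t(\lambda I_{n_i}-U_i)^{-1}\mathbf{1}_{n_i}$. Let $w_i=\sum_{v_l\in N_H(v_i)}n_l$. Let $\rho_{ij}=1$ if $v_iv_j\in E(H)$ and $0$ otherwise, and set $\hat\rho_{ij}=\alpha\rho_{ij}+\gamma$ for $i\neq j$. (i) The characteristic polynomial of $U(G)$ is $$\phi_{U(G)}(\lambda)=\prod_{i=1}^k\phi_i(\lambda-\delta w_i)\Gamma_i(\lambda-\delta w_i)\cdot\det\widetilde U,$$ where $\widetilde U$ is the $k\times k$ matrix with diagonal entries $1/\Gamma_i(\lambda-\delta w_i)$ and off-diagonal entries $-\hat\rho_{ij}$. (ii) Let $\theta^{(i)}_1,\dots,\theta^{(i)}_{m_i}$ be the distinct main eigenvalues of $U_i$. Set $g_i(\lambda)=\prod_{j=1}^{m_i}(\lambda-\delta w_i-\theta^{(i)}_j)$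 and $f_i(\lambda)=g_i(\lambda)\Gamma_i(\lambda-\delta w_i)$; then $f_i$ is a polynomial. Let $\Phi(\lambda)$ be the determinant of the $k\times k$ matrix with diagonal entries $g_i(\lambda)$ and off-diagonal $(i,j)$ entries $-\hat\rho_{ij}f_i(\lambda)$. Then, as a multiset, the spectrum of $U(G)$ consists of: - $\mu+\delta w_i$ for every eigenvalue $\mu$ of $U_i$ that is not a main eigenvalue of $U_i$, with the multiplicity of $\mu$ in $U_i$; - $\mu+\delta w_i$ for every main eigenvalue $\mu$ of $U_i$, with multiplicity one less than that of $\mu$ in $U_i$; - the roots of $\Phi(\lambda)$.
   Context: All graphs are finite and simple. The $H$-join $\bigvee_H\{G_1,\dots,G_k\}$ has vertex set $\bigcup_i V(G_i)$ (disjoint union). Its edge set consists of all edges of each $G_i$ together with all edges $xy$ with $x\in V(G_i)$, $y\in V(G_j)$ whenever $v_iv_j\in E(H)$. The vertices are ordered so that those of $G_1$ come first, then those of $G_2$, and so on. $I_m$ is the identity matrix, $J_m$ the all-ones matrix, $\mathbf{1}_m$ the all-ones vector and $D(\cdot)$ the diagonal degree matrix. An eigenvalue of a real symmetric matrix is a main eigenvalue if its eigenspace is not orthogonal to the all-ones vector. *)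

theory Defs
  imports
    "Graph_Theory.Pair_Digraph"
    "Jordan_Normal_Form.Gauss_Jordan_Elimination"
    "Jordan_Normal_Form.Char_Poly"
    "HOL-Computational_Algebra.Polynomial_Factorial"
    Complex_Main
begin

text \<open>
  A finite simple graph is a \<open>pair_graph\<close>: an undirected edge is represented by its two
  opposite arcs. The family joined along \<open>H\<close> is indexed by the vertices of \<open>H\<close>, so \<open>G v\<^sub>i\<close> is
  the graph attached to \<open>v\<^sub>i\<close>, and the disjoint union is realised by tagging.
\<close>

definition hjoin ::
  "'h pair_pre_digraph \<Rightarrow> ('h \<Rightarrow> 'a pair_pre_digraph) \<Rightarrow> ('h \<times> 'a) pair_pre_digraph" where
  "hjoin H G = \<lparr>
     pverts = (SIGMA u : pverts H. pverts (G u)),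
     parcs = {((u, x), (u, y)) | u x y. u \<in> pverts H \<and> (x, y) \<in> parcs (G u)}
           \<union> {((u, x), (v, y)) | u v x y.
                (u, v) \<in> parcs H \<and> x \<in> pverts (G u) \<and> y \<in> pverts (G v)} \<rparr>"

lemma pair_graph_hjoin:
  assumes H: "pair_graph H" and G: "\<And>u. u \<in> pverts H \<Longrightarrow> pair_graph (G u)"
  shows "pair_graph (hjoin H G)"
proof -
  interpret H: pair_graph H by (rule H)
  note wf = pair_wf_digraph.in_arcsD1 pair_wf_digraph.in_arcsD2
  have Gwf: "pair_wf_digraph (G u)" if "u \<in> pverts H" for u
    using G[OF that] by (simp add: pair_graph_def pair_digraph_def pair_fin_digraph_def)
  have Gsym: "sym (parcs (G u))" if "u \<in> pverts H" for u
    using pair_sym_digraph.pair_sym_arcs[of "G u"] G[OF that]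
    by (simp add: pair_graph_def pair_pseudo_graph_def symmetric_def)
  have Gloop: "(x, x) \<notin> parcs (G u)" if "u \<in> pverts H" for u x
    using pair_loopfree_digraph.pair_no_loops[of "G u" "(x, x)"] G[OF that]
    by (auto simp: pair_graph_def pair_digraph_def)
  have Gfin: "finite (pverts (G u))" if "u \<in> pverts H" for u
    using pair_fin_digraph.pair_finite_verts[of "G u"] G[OF that]
    by (simp add: pair_graph_def pair_digraph_def)
  have Hsym: "sym (parcs H)"
    using H.pair_sym_arcs by (simp add: symmetric_def)
  have Hloop: "(u, u) \<notin> parcs H" for u
    using H.pair_no_loops by fastforce
  have V: "finite (pverts (hjoin H G))"
    using Gfin by (auto simp: hjoin_def)
  have sub: "parcs (hjoin H G) \<subseteq> pverts (hjoin H G) \<times> pverts (hjoin H G)"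
    by (auto simp: hjoin_def dest: wf[OF Gwf] H.in_arcsD1 H.in_arcsD2)
  have fin: "finite (parcs (hjoin H G))"
    using finite_subset[OF sub] V by blast
  have sy: "sym (parcs (hjoin H G))"
    using Gsym Hsym by (auto simp: hjoin_def sym_def)
  have lf: "fst e \<noteq> snd e" if "e \<in> parcs (hjoin H G)" for e
    using that Gloop Hloop by (auto simp: hjoin_def)
  show ?thesis
    by unfold_locales (use sub V fin sy lf in \<open>auto simp: symmetric_def\<close>)
qed

text \<open>
  Matrices of a graph depend on an ordering of its vertices, given as a list \<open>xs\<close> that enumerates
  the vertex set without repetition.
\<close>

definition hjoin_order :: "'h list \<Rightarrow> ('h \<Rightarrow> 'a list) \<Rightarrow> ('h \<times> 'a) list" where
  "hjoin_order vs xs = concat (map (\<lambda>u. map (Pair u) (xs u)) vs)"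

definition adjacency_matrix :: "'a pair_pre_digraph \<Rightarrow> 'a list \<Rightarrow> real mat" where
  "adjacency_matrix G xs =
     mat (length xs) (length xs) (\<lambda>(i, j). if (xs ! i, xs ! j) \<in> parcs G then 1 else 0)"

definition degree_matrix :: "'a pair_pre_digraph \<Rightarrow> 'a list \<Rightarrow> real mat" where
  "degree_matrix G xs =
     mat (length xs) (length xs)
       (\<lambda>(i, j). if i = j then real (card {y. (xs ! i, y) \<in> parcs G}) else 0)"

definition universal_matrix ::
  "real \<Rightarrow> real \<Rightarrow> real \<Rightarrow> real \<Rightarrow> 'a pair_pre_digraph \<Rightarrow> 'a list \<Rightarrow> real mat" where
  "universal_matrix \<alpha> \<beta> \<gamma> \<delta> G xs =
     \<alpha> \<cdot>\<^sub>m adjacency_matrix G xs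
     + \<beta> \<cdot>\<^sub>m 1\<^sub>m (length xs)
     + \<gamma> \<cdot>\<^sub>m mat (length xs) (length xs) (\<lambda>_. 1)
     + \<delta> \<cdot>\<^sub>m degree_matrix G xs"

definition ones_vec :: "nat \<Rightarrow> 'a :: one vec" where
  "ones_vec n = vec n (\<lambda>_. 1)"

definition main_eigenvalue :: "real mat \<Rightarrow> real \<Rightarrow> bool" where
  "main_eigenvalue M \<mu> \<longleftrightarrow> (\<exists>v. eigenvector M v \<mu> \<and> v \<bullet> ones_vec (dim_row M) \<noteq> 0)"

definition coronal :: "'a :: field mat \<Rightarrow> 'a \<Rightarrow> 'a" where
  "coronal M x =
     (let n = dim_row M
      in ones_vec n \<bullet> (the (mat_inverse (x \<cdot>\<^sub>m 1\<^sub>m n - M)) *\<^sub>v ones_vec n))"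

text \<open>
  The rational function \<open>\<Gamma>\<^sub>M(\<lambda> - c)\<close> in the indeterminate \<open>\<lambda>\<close>, as an element of the field of
  fractions of the real polynomials. The matrix inverted here always exists, since its determinant
  is a monic polynomial.
\<close>

definition coronal_fract :: "real mat \<Rightarrow> real \<Rightarrow> real poly fract" where
  "coronal_fract M c = coronal (map_mat (\<lambda>a. to_fract [:a:]) M) (to_fract [:- c, 1:])"

text \<open>
  The spectrum with algebraic multiplicities. It is taken over the complex numbers, so that no
  eigenvalue could be lost even before knowing that symmetric matrices have real spectrum.
\<close>

definition spectrum_mset :: "real mat \<Rightarrow> complex multiset" where
  "spectrum_mset M = proots (char_poly (map_mat complex_of_real M))"

end

theory Submission
  imports Defs
    "Jordan_Normal_Form.Schur_Decomposition"
    "Subresultants.More_Homomorphisms"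
begin

text \<open>
  Write \<open>X - U(G) = B - E R E\<^sup>T\<close>, where \<open>B\<close> is block diagonal with blocks \<open>X - \<delta> w\<^sub>i - U\<^sub>i\<close>, the columns
  of \<open>E\<close> are the indicator vectors of the parts, and \<open>R\<close> carries the off-diagonal weights. If the
  columns of \<open>Y\<close> are the solutions of \<open>B Y = E\<close>, then \<open>E\<^sup>T Y\<close> is the diagonal matrix of the \<open>\<Gamma>\<^sub>i\<close> and
  \<open>det (B - B Y R E\<^sup>T) = det B * det (1 - R E\<^sup>T Y)\<close>, which is (i). For (ii), the orthogonal
  diagonalization of \<open>U\<^sub>i\<close> gives \<open>\<Gamma>\<^sub>i\<close> as a sum of terms \<open>q\<^sub>j\<^sup>2 / (X - \<delta> w\<^sub>i - b\<^sub>j)\<close>, and \<open>q\<^sub>j \<noteq> 0\<close> makes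
  \<open>b\<^sub>j\<close> a main eigenvalue; hence \<open>f\<^sub>i = g\<^sub>i \<Gamma>\<^sub>i\<close> is a polynomial. Clearing denominators in (i) yields
  \<open>\<phi>(U(G)) \<Prod> g\<^sub>i = (\<Prod> \<phi>\<^sub>i) \<Phi>\<close>, and the multisets of roots can be compared by cancellation.
\<close>

section \<open>Determinants of block matrices\<close>

text \<open>\<open>?M\<close> and the unipotent \<open>?N\<close> multiply to a block triangular
  matrix in either order. One order leaves \<open>1 - X * Y\<close> beside an identity block, the
  other leaves \<open>1 - Y * X\<close>, and the determinant of a product does not depend on the
  order. This is what reduces an n by n determinant to a k by k one.\<close>

lemma det_one_minus_mult_commute:
  fixes X :: "'a :: idom mat"
  assumes X: "X \<in> carrier_mat n k" and Y: "Y \<in> carrier_mat k n"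
  shows "det (1\<^sub>m n - X * Y) = det (1\<^sub>m k - Y * X)"
proof -
  let ?M = "four_block_mat (1\<^sub>m n) X Y (1\<^sub>m k)"
  let ?N = "four_block_mat (1\<^sub>m n) (0\<^sub>m n k) (- Y) (1\<^sub>m k)"
  note c = one_carrier_mat[of n] one_carrier_mat[of k] zero_carrier_mat[of n k]
  have mY: "- Y \<in> carrier_mat k n" using Y by simp
  have M: "?M \<in> carrier_mat (n + k) (n + k)" and N: "?N \<in> carrier_mat (n + k) (n + k)"
    by (simp_all add: four_block_carrier_mat)
  have "?M * ?N = four_block_mat (1\<^sub>m n - X * Y) X (0\<^sub>m k n) (1\<^sub>m k)"
    by (subst mult_four_block_mat[OF c(1) X Y c(2) c(1) c(3) mY c(2)])
       (use X Y in \<open>auto intro!: arg_cong4[of _ _ _ _ _ _ _ _ four_block_mat] eq_matI\<close>)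
  moreover have "1\<^sub>m n - X * Y \<in> carrier_mat n n" and "1\<^sub>m k - Y * X \<in> carrier_mat k k"
    using X Y by auto
  ultimately have "det (?M * ?N) = det (1\<^sub>m n - X * Y)"
    using det_four_block_mat_lower_left_zero[of "1\<^sub>m n - X * Y" n X k "0\<^sub>m k n" "1\<^sub>m k"] X Y by simp
  moreover have "?N * ?M = four_block_mat (1\<^sub>m n) X (0\<^sub>m k n) (1\<^sub>m k - Y * X)"
    by (subst mult_four_block_mat[OF c(1) c(3) mY c(2) c(1) X Y c(2)])
       (use X Y in \<open>auto intro!: arg_cong4[of _ _ _ _ _ _ _ _ four_block_mat] eq_matI\<close>)
  then have "det (?N * ?M) = det (1\<^sub>m k - Y * X)"
    using det_four_block_mat_lower_left_zero[of "1\<^sub>m n" n X k "0\<^sub>m k n" "1\<^sub>m k - Y * X"] X Y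
    by (simp add: minus_carrier_mat)
  ultimately show ?thesis
    using det_mult[OF M N] det_mult[OF N M] by (simp add: mult.commute)
qed

text \<open>Entries are given by a function on vertices instead of positions, so that blocks of the
  join can be described by the tag of a vertex, without index offsets.\<close>

definition list_mat :: "'v list \<Rightarrow> ('v \<Rightarrow> 'v \<Rightarrow> 'a) \<Rightarrow> 'a mat" where
  "list_mat L F = mat (length L) (length L) (\<lambda>(i, j). F (L ! i) (L ! j))"

lemma list_mat_carrier [simp]: "list_mat L F \<in> carrier_mat (length L) (length L)"
  by (simp add: list_mat_def)

lemma list_mat_dim [simp]:
  "dim_row (list_mat L F) = length L" "dim_col (list_mat L F) = length L"
  by (simp_all add: list_mat_def)

lemma list_mat_index [simp]:
  "i < length L \<Longrightarrow> j < length L \<Longrightarrow> list_mat L F $$ (i, j) = F (L ! i) (L ! j)"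
  by (simp add: list_mat_def)

lemma list_mat_cong:
  assumes "\<And>a b. a \<in> set L \<Longrightarrow> b \<in> set L \<Longrightarrow> F a b = F' a b"
  shows "list_mat L F = list_mat L F'"
  by (rule eq_matI) (use assms in auto)

lemma sum_nth_distinct:
  assumes "distinct L"
  shows "(\<Sum>i<length L. f (L ! i)) = (\<Sum>a\<in>set L. f a)"
  using assms by (simp add: sum.distinct_set_conv_list sum_list_sum_nth atLeast0LessThan)

lemma list_mat_mult:
  fixes F :: "'v \<Rightarrow> 'v \<Rightarrow> 'a :: semiring_0"
  assumes "distinct L"
  shows "list_mat L F * list_mat L F' = list_mat L (\<lambda>a b. \<Sum>c\<in>set L. F a c * F' c b)"
proof (rule eq_matI)
  fix i j assume "i < dim_row (list_mat L (\<lambda>a b. \<Sum>c\<in>set L. F a c * F' c b))"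
    and "j < dim_col (list_mat L (\<lambda>a b. \<Sum>c\<in>set L. F a c * F' c b))"
  then show "(list_mat L F * list_mat L F') $$ (i, j)
      = list_mat L (\<lambda>a b. \<Sum>c\<in>set L. F a c * F' c b) $$ (i, j)"
    using sum_nth_distinct[OF assms, of "\<lambda>c. F (L ! i) c * F' c (L ! j)"]
    by (simp add: scalar_prod_def atLeast0LessThan)
qed auto

text \<open>The hypothesis kills the upper right block, leaving a block triangular matrix. Peeling
  off the head of a list in this way drives the inductions for block diagonal and diagonal
  matrices.\<close>

lemma det_list_mat_append:
  fixes F :: "'v \<Rightarrow> 'v \<Rightarrow> 'a :: idom"
  assumes "\<And>a b. a \<in> set L \<Longrightarrow> b \<in> set L' \<Longrightarrow> F a b = 0"
  shows "det (list_mat (L @ L') F) = det (list_mat L F) * det (list_mat L' F)"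
proof -
  let ?C = "mat (length L') (length L) (\<lambda>(i, j). F (L' ! i) (L ! j))"
  have "list_mat (L @ L') F =
      four_block_mat (list_mat L F) (0\<^sub>m (length L) (length L')) ?C (list_mat L' F)"
    by (rule eq_matI) (use assms in \<open>auto simp: nth_append\<close>)
  then show ?thesis
    by (simp add: det_four_block_mat_upper_right_zero[of _ "length L" _ "length L'"])
qed

lemma det_list_mat_map:
  "det (list_mat (map h L) F) = det (list_mat L (\<lambda>a b. F (h a) (h b)))"
  by (rule arg_cong[of _ _ det], rule eq_matI) auto

section \<open>Determinants along the vertex order of a join\<close>

lemma set_hjoin_order: "set (hjoin_order vs xs) = (SIGMA u : set vs. set (xs u))"
  by (auto simp: hjoin_order_def)

lemma distinct_hjoin_order:
  assumes "distinct vs" and "\<And>u. u \<in> set vs \<Longrightarrow> distinct (xs u)"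
  shows "distinct (hjoin_order vs xs)"
  using assms
proof (induction vs)
  case (Cons u vs)
  moreover have "inj (Pair u)" by (simp add: inj_on_def)
  ultimately show ?case
    by (auto simp: hjoin_order_def distinct_map inj_on_def)
qed (simp add: hjoin_order_def)

text \<open>Induction on \<open>vs\<close>: since the head differs from all later tags, the first
  block meets the remaining ones only in zeros.\<close>

lemma det_block_diagonal:
  fixes m :: "'h \<Rightarrow> 'x \<Rightarrow> 'x \<Rightarrow> 'a :: idom"
  assumes "distinct vs"
  shows "det (list_mat (hjoin_order vs xs)
           (\<lambda>(u, x) (v, y). if u = v then m u x y else 0))
       = (\<Prod>u\<in>set vs. det (list_mat (xs u) (m u)))"
  using assms
proof (induction vs)
  case Nil
  then show ?case by (simp add: hjoin_order_def list_mat_def det_def)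
next
  case (Cons u vs)
  let ?F = "\<lambda>(u, x) (v, y). if u = v then m u x y else 0"
  have "det (list_mat (map (Pair u) (xs u) @ hjoin_order vs xs) ?F)
      = det (list_mat (map (Pair u) (xs u)) ?F) * det (list_mat (hjoin_order vs xs) ?F)"
    by (rule det_list_mat_append) (use Cons.prems in \<open>auto simp: set_hjoin_order\<close>)
  moreover have "hjoin_order (u # vs) xs = map (Pair u) (xs u) @ hjoin_order vs xs"
    by (simp add: hjoin_order_def)
  ultimately show ?case
    using Cons by (simp add: det_list_mat_map)
qed

lemma det_list_mat_diagonal:
  fixes d :: "'v \<Rightarrow> 'a :: idom"
  assumes "distinct L"
  shows "det (list_mat L (\<lambda>a b. if a = b then d a else 0)) = (\<Prod>a\<in>set L. d a)"
  using assms
proof (induction L)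
  case Nil
  then show ?case by (simp add: list_mat_def det_def)
next
  case (Cons a L)
  have "det (list_mat ([a] @ L) (\<lambda>a b. if a = b then d a else 0))
      = det (list_mat [a] (\<lambda>a b. if a = b then d a else 0)) *
        det (list_mat L (\<lambda>a b. if a = b then d a else 0))"
    by (rule det_list_mat_append) (use Cons.prems in auto)
  moreover have "det (list_mat [a] (\<lambda>a b. if a = b then d a else 0)) = d a"
    by (subst det_single) (auto simp: list_mat_def)
  ultimately show ?case
    using Cons by simp
qed

text \<open>Row scaling is multiplication by a diagonal matrix from the left. It serves to clear the
  denominators 1/\<Gamma> when passing to \<Phi>.\<close>

lemma det_list_mat_scale_rows:
  fixes F :: "'v \<Rightarrow> 'v \<Rightarrow> 'a :: idom"
  assumes "distinct L"
  shows "det (list_mat L (\<lambda>a b. d a * F a b)) = (\<Prod>a\<in>set L. d a) * det (list_mat L F)"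
proof -
  have "list_mat L (\<lambda>a b. d a * F a b)
      = list_mat L (\<lambda>a b. if a = b then d a else 0) * list_mat L F"
    unfolding list_mat_mult[OF assms]
    by (rule list_mat_cong) (simp add: if_distrib[of "\<lambda>x. x * _"] cong: if_cong)
  then show ?thesis
    by (simp add: det_mult[of _ "length L"] det_list_mat_diagonal assms)
qed

text \<open>The mirror image, with the diagonal matrix on the right. It pulls the factors \<Gamma>
  out of the reduced k by k determinant.\<close>

lemma det_list_mat_scale_columns:
  fixes F :: "'v \<Rightarrow> 'v \<Rightarrow> 'a :: idom"
  assumes "distinct L"
  shows "det (list_mat L (\<lambda>a b. F a b * d b)) = (\<Prod>a\<in>set L. d a) * det (list_mat L F)"
proof -
  have "list_mat L (\<lambda>a b. F a b * d b)
      = list_mat L F * list_mat L (\<lambda>a b. if a = b then d a else 0)"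
    unfolding list_mat_mult[OF assms]
    by (rule list_mat_cong) (simp add: if_distrib[of "\<lambda>x. _ * x"] cong: if_cong)
  then show ?thesis
    by (simp add: det_mult[of _ "length L"] det_list_mat_diagonal assms)
qed

text \<open>The matrix factors as \<open>?B * (1 - X * Z)\<close>: the columns of \<open>X\<close>
  hold the solutions \<open>s\<close>, so \<open>?B * X\<close> is the indicator matrix of the
  parts, and \<open>Z\<close> spreads the weights over them. Exchanging \<open>X\<close> and
  \<open>Z\<close> then leaves a matrix indexed by the parts. Taking \<open>s\<close> as given,
  instead of inverting the blocks, keeps the argument valid over an integral domain.\<close>

lemma det_join:
  fixes m :: "'h \<Rightarrow> 'x \<Rightarrow> 'x \<Rightarrow> 'a :: idom" and r :: "'h \<Rightarrow> 'h \<Rightarrow> 'a"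
  assumes vs: "distinct vs" and xs: "\<And>u. u \<in> set vs \<Longrightarrow> distinct (xs u)"
    and s: "\<And>u x. u \<in> set vs \<Longrightarrow> x \<in> set (xs u) \<Longrightarrow> (\<Sum>y\<in>set (xs u). m u x y * s u y) = 1"
  shows "det (list_mat (hjoin_order vs xs)
           (\<lambda>(u, x) (v, y). if u = v then m u x y else - r u v))
       = (\<Prod>u\<in>set vs. det (list_mat (xs u) (m u))) *
         det (list_mat vs (\<lambda>u v. if u = v then 1 else - r u v * (\<Sum>y\<in>set (xs v). s v y)))"
proof -
  define L where "L = hjoin_order vs xs"
  have L: "distinct L" "set L = (SIGMA u : set vs. set (xs u))"
    using distinct_hjoin_order[OF vs xs] by (auto simp: L_def set_hjoin_order)
  \<comment> \<open>The diagonal weights are zeroed because the blocks on the diagonal must come out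
    of the product unchanged.\<close>
  define r' where "r' u v = (if u = v then 0 else r u v)" for u v
  let ?B = "list_mat L (\<lambda>(u, x) (v, y). if u = v then m u x y else 0)"
  define X where "X = mat (length L) (length vs)
    (\<lambda>(i, j). if fst (L ! i) = vs ! j then s (fst (L ! i)) (snd (L ! i)) else 0)"
  define Z where "Z = mat (length vs) (length L) (\<lambda>(i, j). r' (vs ! i) (fst (L ! j)))"
  have X: "X \<in> carrier_mat (length L) (length vs)" and Z: "Z \<in> carrier_mat (length vs) (length L)"
    by (auto simp: X_def Z_def)
  have "X * Z = list_mat L (\<lambda>(u, x) (v, y). s u x * r' u v)"
  proof (rule eq_matI)
    fix i j assume "i < dim_row (list_mat L (\<lambda>(u, x) (v, y). s u x * r' u v))"
      and "j < dim_col (list_mat L (\<lambda>(u, x) (v, y). s u x * r' u v))"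
    then have ij: "i < length L" "j < length L" by auto
    then have "fst (L ! i) \<in> set vs" using L(2) nth_mem[of i L] by auto
    then show "(X * Z) $$ (i, j) = list_mat L (\<lambda>(u, x) (v, y). s u x * r' u v) $$ (i, j)"
      using ij sum_nth_distinct[OF vs, of "\<lambda>c. (if fst (L ! i) = c
        then s (fst (L ! i)) (snd (L ! i)) else 0) * r' c (fst (L ! j))"]
      by (simp add: X_def Z_def scalar_prod_def atLeast0LessThan case_prod_beta
          if_distrib[of "\<lambda>x. x * _"] cong: if_cong)
  qed (use X Z in auto)
  then have 1: "1\<^sub>m (length L) - X * Z
      = list_mat L (\<lambda>a b. (if a = b then 1 else 0) - s (fst a) (snd a) * r' (fst a) (fst b))"
    by (intro eq_matI) (auto simp: nth_eq_iff_index_eq[OF L(1)] case_prod_beta)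
  \<comment> \<open>Only the part of the row index contributes to the sum. The identity yields the
    entry of \<open>m\<close>, and the equation for \<open>s\<close> collapses the other term to the
    bare weight \<open>r' u v\<close>.\<close>
  have 2: "?B * (1\<^sub>m (length L) - X * Z)
      = list_mat L (\<lambda>(u, x) (v, y). if u = v then m u x y else - r u v)"
    unfolding 1 list_mat_mult[OF L(1)]
  proof (rule list_mat_cong)
    fix a b assume "a \<in> set L" "b \<in> set L"
    moreover obtain u x v y where [simp]: "a = (u, x)" "b = (v, y)" by (cases a, cases b)
    ultimately have m: "u \<in> set vs" "x \<in> set (xs u)" "v \<in> set vs" "y \<in> set (xs v)"
      using L(2) by auto
    have "(\<Sum>c\<in>set L. (case a of (u, x) \<Rightarrow> \<lambda>(v, y). if u = v then m u x y else 0) c *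
        ((if c = b then 1 else 0) - s (fst c) (snd c) * r' (fst c) (fst b)))
      = (\<Sum>w\<in>set vs. \<Sum>z\<in>set (xs w). (if u = w then m u x z else 0) *
        ((if (w, z) = (v, y) then 1 else 0) - s w z * r' w v))"
      unfolding L(2) by (subst sum.Sigma) (auto intro!: sum.cong simp: case_prod_beta)
    also have "\<dots> = (\<Sum>w\<in>set vs. if w = u then (\<Sum>z\<in>set (xs w). m u x z *
        ((if (w, z) = (v, y) then 1 else 0) - s w z * r' w v)) else 0)"
      by (intro sum.cong) (auto intro!: sum.neutral)
    also have "\<dots> = (\<Sum>z\<in>set (xs u). m u x z *
        ((if (u, z) = (v, y) then 1 else 0) - s u z * r' u v))"
      using m by simp
    also have "\<dots> = (\<Sum>z\<in>set (xs u). if z = y then (if u = v then m u x z else 0) else 0)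
        - (\<Sum>z\<in>set (xs u). m u x z * s u z) * r' u v"
      unfolding sum_subtractf[symmetric] sum_distrib_right
      by (intro sum.cong) (auto simp: algebra_simps)
    also have "\<dots> = (if u = v then m u x y else - r u v)"
      using m s[of u x] by (auto simp: r'_def)
    finally show "(\<Sum>c\<in>set L. (case a of (u, x) \<Rightarrow> \<lambda>(v, y). if u = v then m u x y else 0) c *
        ((if c = b then 1 else 0) - s (fst c) (snd c) * r' (fst c) (fst b)))
      = (case a of (u, x) \<Rightarrow> \<lambda>(v, y). if u = v then m u x y else - r u v) b" by simp
  qed
  have 3: "1\<^sub>m (length vs) - Z * X
      = list_mat vs (\<lambda>u v. if u = v then 1 else - r u v * (\<Sum>y\<in>set (xs v). s v y))"
  proof (rule eq_matI)
    fix i j assume "i < dim_row (list_mat vs (\<lambda>u v. if u = v then 1 else - r u v * (\<Sum>y\<in>set (xs v). s v y)))"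
      and "j < dim_col (list_mat vs (\<lambda>u v. if u = v then 1 else - r u v * (\<Sum>y\<in>set (xs v). s v y)))"
    then have ij: "i < length vs" "j < length vs" by auto
    have "(Z * X) $$ (i, j) = (\<Sum>a\<in>set L. r' (vs ! i) (fst a) *
        (if fst a = vs ! j then s (fst a) (snd a) else 0))"
      using ij sum_nth_distinct[OF L(1), of "\<lambda>a. r' (vs ! i) (fst a) *
        (if fst a = vs ! j then s (fst a) (snd a) else 0)"]
      by (simp add: X_def Z_def scalar_prod_def atLeast0LessThan)
    also have "\<dots> = (\<Sum>w\<in>set vs. \<Sum>z\<in>set (xs w). r' (vs ! i) w * (if w = vs ! j then s w z else 0))"
      unfolding L(2) by (subst sum.Sigma) (auto intro!: sum.cong)
    also have "\<dots> = (\<Sum>w\<in>set vs. if w = vs ! j then r' (vs ! i) w * (\<Sum>z\<in>set (xs w). s w z) else 0)"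
      by (intro sum.cong) (auto simp: sum_distrib_left)
    also have "\<dots> = r' (vs ! i) (vs ! j) * (\<Sum>y\<in>set (xs (vs ! j)). s (vs ! j) y)"
      using ij by simp
    finally show "(1\<^sub>m (length vs) - Z * X) $$ (i, j)
      = list_mat vs (\<lambda>u v. if u = v then 1 else - r u v * (\<Sum>y\<in>set (xs v). s v y)) $$ (i, j)"
      using ij X Z nth_eq_iff_index_eq[OF vs ij] by (auto simp: r'_def)
  qed (use X Z in auto)
  have c: "1\<^sub>m (length L) - X * Z \<in> carrier_mat (length L) (length L)"
    using X Z by (auto simp: 1)
  show ?thesis
    using det_mult[OF list_mat_carrier c, of "\<lambda>(u, x) (v, y). if u = v then m u x y else 0"]
      det_one_minus_mult_commute[OF X Z] det_block_diagonal[OF vs, of xs m]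
    by (simp add: 2 3 flip: L_def)
qed

section \<open>Real symmetric matrices\<close>

text \<open>A complex eigenvalue exists by the fundamental theorem of algebra, and symmetry forces
  it to be real.\<close>

lemma real_symmetric_eigenvalue_exists:
  fixes A :: "real mat"
  assumes A: "A \<in> carrier_mat n n" and sym: "A\<^sup>T = A" and n: "n > 0"
  shows "\<exists>e. eigenvalue A e"
proof -
  let ?A = "map_mat complex_of_real A"
  have A': "?A \<in> carrier_mat n n" using A by simp
  have "degree (char_poly ?A) = n" using degree_monic_char_poly[OF A'] by simp
  then have "\<not> constant (poly (char_poly ?A))" using n by (simp add: constant_degree)
  then obtain z where z: "poly (char_poly ?A) z = 0"
    using fundamental_theorem_of_algebra by blast
  then obtain v where "eigenvector ?A v z"
    using eigenvalue_root_char_poly[OF A'] unfolding eigenvalue_def by blast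
  then have v: "v \<in> carrier_vec n" "v \<noteq> 0\<^sub>v n" and Av: "?A *\<^sub>v v = z \<cdot>\<^sub>v v"
    using A by (auto simp: eigenvector_def)
  have row: "(\<Sum>j<n. of_real (A $$ (i, j)) * v $ j) = z * v $ i" if "i < n" for i
    using arg_cong[OF Av, of "\<lambda>w. w $ i"] that A v
    by (simp add: scalar_prod_def atLeast0LessThan)
  have symA: "A $$ (i, j) = A $$ (j, i)" if "i < n" "j < n" for i j
    using arg_cong[OF sym, of "\<lambda>M. M $$ (i, j)"] that A by simp
  \<comment> \<open>\<open>S\<close> is the squared norm of \<open>v\<close> and \<open>T\<close>
    the Hermitian form of \<open>A\<close> at \<open>v\<close>. Both are fixed by conjugation and
    \<open>T = z * S\<close> with \<open>S\<close> nonzero, so \<open>z\<close> is real.\<close>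
  define S where "S = (\<Sum>i<n. cnj (v $ i) * v $ i)"
  define T where "T = (\<Sum>i<n. \<Sum>j<n. cnj (v $ i) * (of_real (A $$ (i, j)) * v $ j))"
  have "T = (\<Sum>i<n. cnj (v $ i) * (z * v $ i))"
    unfolding T_def by (intro sum.cong refl) (simp add: row flip: sum_distrib_left)
  then have "T = z * S"
    by (simp add: S_def sum_distrib_left algebra_simps)
  moreover have "cnj T = T"
  proof -
    have "cnj T = (\<Sum>i<n. \<Sum>j<n. cnj (v $ j) * (of_real (A $$ (j, i)) * v $ i))"
      unfolding T_def by (auto intro!: sum.cong simp: symA)
    also have "\<dots> = T" unfolding T_def by (rule sum.swap)
    finally show ?thesis .
  qed
  moreover have "cnj S = S" unfolding S_def by (simp add: mult.commute)
  moreover have "S \<noteq> 0"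
  proof -
    obtain i where i: "i < n" "v $ i \<noteq> 0"
      using v by (metis carrier_vecD eq_vecI index_zero_vec)
    have S: "S = of_real (\<Sum>i<n. (cmod (v $ i))\<^sup>2)"
      unfolding S_def by (simp add: complex_norm_square mult.commute del: of_real_power)
    have "0 < (\<Sum>i<n. (cmod (v $ i))\<^sup>2)"
      by (rule sum_pos2[of _ i]) (use i in auto)
    then show ?thesis unfolding S of_real_eq_0_iff by linarith
  qed
  ultimately have "cnj z = z" by (metis complex_cnj_mult mult_right_cancel)
  then obtain e where "z = of_real e" by (metis Reals_cases Reals_cnj_iff)
  then have "poly (char_poly A) e = 0"
    using z by (simp add: of_real_hom.char_poly_hom[OF A])
  then show ?thesis using eigenvalue_root_char_poly[OF A] by blast
qed

text \<open>Gram-Schmidt is applied to a basis that starts with \<open>v\<close>. It leaves the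
  first vector in place, so after normalization the first column is a multiple of
  \<open>v\<close>.\<close>

lemma real_orthogonal_completion:
  fixes v :: "real vec"
  assumes v: "v \<in> carrier_vec n" "v \<noteq> 0\<^sub>v n"
  shows "\<exists>W c. W \<in> carrier_mat n n \<and> W\<^sup>T * W = 1\<^sub>m n \<and> c \<noteq> 0 \<and> col W 0 = c \<cdot>\<^sub>v v"
proof -
  interpret cof_vec_space n "TYPE(real)" .
  define b where "b = basis_completion v"
  define ws where "ws = gram_schmidt n b"
  have n: "n > 0" using v by (cases n) auto
  note b = basis_completion[OF v, folded b_def]
  have ws: "set ws \<subseteq> carrier_vec n" "corthogonal ws" "length ws = n"
    using gram_schmidt_result[OF b(2,4,5) refl, folded ws_def] b(6) by auto
  obtain bs where bv: "b = v # bs" using b(6,7) n by (cases b) auto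
  have hd: "hd ws = v" unfolding ws_def bv by (rule gram_schmidt_hd[OF v(1)])
  \<comment> \<open>Conjugation is trivial on real vectors, so \<open>corthogonal\<close> means
    ordinary orthogonality of nonzero vectors.\<close>
  have dot: "(ws ! i \<bullet> ws ! j = 0) = (i \<noteq> j)" if "i < n" "j < n" for i j
    using corthogonalD[OF ws(2), of i j] ws(3) that by (simp add: conjugate_vec_def vec_eq_iff)
  define d where "d i = 1 / sqrt (ws ! i \<bullet> ws ! i)" for i
  define W where "W = mat_of_cols n (map (\<lambda>i. d i \<cdot>\<^sub>v ws ! i) [0..<n])"
  have wsc: "ws ! i \<in> carrier_vec n" if "i < n" for i using ws that by auto
  have pos: "ws ! i \<bullet> ws ! i > 0" if "i < n" for i
    using dot[OF that that] by (simp add: scalar_prod_def order_less_le sum_nonneg)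
  have W: "W \<in> carrier_mat n n" unfolding W_def by auto
  have colW: "col W i = d i \<cdot>\<^sub>v ws ! i" if "i < n" for i
    unfolding W_def using that wsc[OF that] by (subst col_mat_of_cols) auto
  have "W\<^sup>T * W = 1\<^sub>m n"
  proof (rule eq_matI)
    fix i j assume "i < dim_row (1\<^sub>m n)" "j < dim_col (1\<^sub>m n :: real mat)"
    then have ij: "i < n" "j < n" by auto
    have "(W\<^sup>T * W) $$ (i, j) = d i * (d j * (ws ! i \<bullet> ws ! j))"
      using W ij wsc[OF ij(1)] wsc[OF ij(2)]
      by (simp add: colW smult_scalar_prod_distrib[of _ n] scalar_prod_smult_distrib[of _ n])
    also have "\<dots> = 1\<^sub>m n $$ (i, j)"
      using ij dot[OF ij] pos[OF ij(1)] by (auto simp: d_def field_simps)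
    finally show "(W\<^sup>T * W) $$ (i, j) = 1\<^sub>m n $$ (i, j)" .
  qed (use W in auto)
  moreover have "d 0 \<noteq> 0" using pos[OF n] by (simp add: d_def)
  moreover have "col W 0 = d 0 \<cdot>\<^sub>v v"
    using colW[OF n] hd ws(3) n by (metis hd_conv_nth length_greater_0_conv)
  ultimately show ?thesis using W by blast
qed

text \<open>Induction by deflation: an orthogonal change of basis that puts an eigenvector first
  splits off a 1 by 1 block, and the induction hypothesis diagonalizes the symmetric matrix that
  remains.\<close>

lemma real_symmetric_diagonalization:
  fixes A :: "real mat"
  assumes "A \<in> carrier_mat n n" and "A\<^sup>T = A"
  shows "\<exists>P D. P \<in> carrier_mat n n \<and> D \<in> carrier_mat n n \<and> diagonal_mat D \<and>
    P\<^sup>T * P = 1\<^sub>m n \<and> A = P * D * P\<^sup>T"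
  using assms
proof (induction n arbitrary: A)
  case 0
  then show ?case by (intro exI[of _ A] conjI) (auto simp: diagonal_mat_def)
next
  case (Suc n A)
  note A = Suc.prems(1)
  let ?m = "Suc n"
  obtain e v where "eigenvector A v e"
    using real_symmetric_eigenvalue_exists[OF Suc.prems] unfolding eigenvalue_def by auto
  then have v: "v \<in> carrier_vec ?m" "v \<noteq> 0\<^sub>v ?m" and Av: "A *\<^sub>v v = e \<cdot>\<^sub>v v"
    using A by (auto simp: eigenvector_def)
  obtain W c where W: "W \<in> carrier_mat ?m ?m" and WW: "W\<^sup>T * W = 1\<^sub>m ?m"
    and W0: "col W 0 = c \<cdot>\<^sub>v v"
    using real_orthogonal_completion[OF v] by blast
  have Wt: "W\<^sup>T \<in> carrier_mat ?m ?m" using W by simp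
  have WW': "W * W\<^sup>T = 1\<^sub>m ?m" using mat_mult_left_right_inverse[OF Wt W WW] .
  define A' where "A' = W\<^sup>T * A * W"
  have A': "A' \<in> carrier_mat ?m ?m" using A W by (simp add: A'_def)
  have symA': "A'\<^sup>T = A'"
  proof -
    have "A'\<^sup>T = W\<^sup>T * (A\<^sup>T * (W\<^sup>T)\<^sup>T)"
      unfolding A'_def using A W Wt by (simp add: transpose_mult[of _ ?m ?m _ ?m])
    also have "\<dots> = A'" unfolding A'_def Suc.prems(2) using A W Wt by simp
    finally show ?thesis .
  qed
  have sym': "A' $$ (i, j) = A' $$ (j, i)" if "i < ?m" "j < ?m" for i j
    using arg_cong[OF symA', of "\<lambda>M. M $$ (i, j)"] that A' by simp
  \<comment> \<open>The first column of \<open>W\<close> is an eigenvector and the columns of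
    \<open>W\<close> are orthonormal.\<close>
  have col0: "A' $$ (i, 0) = (if i = 0 then e else 0)" if i: "i < ?m" for i
  proof -
    have "A' = W\<^sup>T * (A * W)" unfolding A'_def using A W Wt by simp
    then have "A' $$ (i, 0) = col W i \<bullet> (A *\<^sub>v col W 0)"
      using i A W by (simp add: col_mult2[OF A W] mult_mat_vec_def)
    also have "A *\<^sub>v col W 0 = e \<cdot>\<^sub>v col W 0"
      unfolding W0 using A v Av by (simp add: mult_mat_vec smult_smult_assoc mult.commute)
    also have "col W i \<bullet> (e \<cdot>\<^sub>v col W 0) = e * (W\<^sup>T * W) $$ (i, 0)"
      using i W by simp
    also have "\<dots> = (if i = 0 then e else 0)" unfolding WW using i by simp
    finally show ?thesis .
  qed
  define A3 where "A3 = mat n n (\<lambda>(i, j). A' $$ (Suc i, Suc j))"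
  have A3: "A3 \<in> carrier_mat n n" by (simp add: A3_def)
  have "A3\<^sup>T = A3" by (rule eq_matI) (auto simp: A3_def sym')
  from Suc.IH[OF A3 this] obtain P D where P: "P \<in> carrier_mat n n" and D: "D \<in> carrier_mat n n"
    and diag: "diagonal_mat D" and PP: "P\<^sup>T * P = 1\<^sub>m n" and A3_eq: "A3 = P * D * P\<^sup>T" by blast
  let ?E = "mat 1 1 (\<lambda>_. e)"
  let ?b = "\<lambda>X Y. four_block_mat X (0\<^sub>m 1 n) (0\<^sub>m n 1) Y"
  note z = zero_carrier_mat[of 1 n, where ?'a = real] zero_carrier_mat[of n 1, where ?'a = real]
  have Pt: "P\<^sup>T \<in> carrier_mat n n" using P by simp
  have o: "(1\<^sub>m 1 :: real mat) \<in> carrier_mat 1 1" by simp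
  have E: "?E \<in> carrier_mat 1 1" by simp
  define Q where "Q = ?b (1\<^sub>m 1) P"
  define F where "F = ?b ?E D"
  have Q: "Q \<in> carrier_mat ?m ?m" and F: "F \<in> carrier_mat ?m ?m"
    unfolding Q_def F_def using four_block_carrier_mat[OF o P] four_block_carrier_mat[OF E D] by auto
  have blockmult: "?b X Y * ?b X' Y' = ?b (X * X') (Y * Y')"
    if "X \<in> carrier_mat 1 1" "X' \<in> carrier_mat 1 1" "Y \<in> carrier_mat n n" "Y' \<in> carrier_mat n n"
    for X X' Y Y' :: "real mat"
    using mult_four_block_mat[OF that(1) z that(3) that(2) z that(4)] that by simp
  have Qt: "Q\<^sup>T = ?b (1\<^sub>m 1) (P\<^sup>T)"
    unfolding Q_def using transpose_four_block_mat[OF o z P] by simp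
  \<comment> \<open>Column 0 is known from \<open>col0\<close>, and row 0 follows from it by
    symmetry.\<close>
  have "A' = ?b ?E A3"
  proof (rule eq_matI)
    fix i j assume "i < dim_row (?b ?E A3)" "j < dim_col (?b ?E A3)"
    then have "i < ?m" "j < ?m" using A3 by auto
    then show "A' $$ (i, j) = ?b ?E A3 $$ (i, j)"
      using A3 col0[of i] col0[of j] sym'[of 0 j] by (cases i; cases j) (auto simp: A3_def)
  qed (use A' A3 in auto)
  also have "\<dots> = ?b (1\<^sub>m 1 * ?E * 1\<^sub>m 1) (P * D * P\<^sup>T)"
    unfolding left_mult_one_mat[OF E] right_mult_one_mat[OF E] A3_eq ..
  also have "\<dots> = Q * F * Q\<^sup>T"
    unfolding Qt unfolding Q_def F_def blockmult[OF o E P D]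
    by (rule blockmult[symmetric]) (use P D Pt in auto)
  finally have A'Q: "A' = Q * F * Q\<^sup>T" .
  have QQ: "Q\<^sup>T * Q = 1\<^sub>m ?m"
    unfolding Qt unfolding Q_def blockmult[OF o o Pt P] PP by simp
  have dF: "diagonal_mat F"
    using diag D by (auto simp: diagonal_mat_def F_def)
  have Qtc: "Q\<^sup>T \<in> carrier_mat ?m ?m" using Q by simp
  have tWQ: "(W * Q)\<^sup>T = Q\<^sup>T * W\<^sup>T" using W Q by (rule transpose_mult)
  have "(W * Q)\<^sup>T * (W * Q) = Q\<^sup>T * (W\<^sup>T * W) * Q"
    unfolding tWQ using W Wt Q Qtc by (simp add: assoc_mult_mat[of _ ?m ?m _ ?m _ ?m])
  also have "\<dots> = 1\<^sub>m ?m" unfolding WW using Q Qtc QQ by simp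
  finally have 1: "(W * Q)\<^sup>T * (W * Q) = 1\<^sub>m ?m" .
  have "A = (W * W\<^sup>T) * A * (W * W\<^sup>T)" unfolding WW' using A by simp
  also have "\<dots> = W * A' * W\<^sup>T"
    unfolding A'_def using A W Wt by (simp add: assoc_mult_mat[of _ ?m ?m _ ?m _ ?m])
  also have "\<dots> = (W * Q) * F * (W * Q)\<^sup>T"
    unfolding tWQ A'Q using W Wt Q Qtc F by (simp add: assoc_mult_mat[of _ ?m ?m _ ?m _ ?m])
  finally show ?case
    using 1 W Q F dF by (intro exI[of _ "W * Q"] exI[of _ F]) auto
qed

section \<open>The coronal\<close>

lemma mat_inverse_if_det_nonzero:
  fixes M :: "'a :: field mat"
  assumes M: "M \<in> carrier_mat n n" and det: "det M \<noteq> 0"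
  obtains B where "mat_inverse M = Some B" "M * B = 1\<^sub>m n" "B * M = 1\<^sub>m n" "B \<in> carrier_mat n n"
proof -
  have "M \<in> Units (ring_mat TYPE('a) n ())"
    by (rule det_non_zero_imp_unit[OF M det])
  then obtain B where "mat_inverse M = Some B"
    using mat_inverse(1)[OF M, of "()"] by (cases "mat_inverse M") auto
  then show ?thesis using that mat_inverse(2)[OF M] by blast
qed

text \<open>The inverse applied to the all-ones vector is the only solution of the linear system, so
  the coronal can be read off from any solution without computing an inverse.\<close>

lemma coronal_eqI:
  fixes A :: "'a :: field mat"
  assumes A: "A \<in> carrier_mat n n" and y: "y \<in> carrier_vec n"
    and det: "det (x \<cdot>\<^sub>m 1\<^sub>m n - A) \<noteq> 0"
    and eq: "(x \<cdot>\<^sub>m 1\<^sub>m n - A) *\<^sub>v y = ones_vec n"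
  shows "coronal A x = (\<Sum>i<n. y $ i)"
proof -
  let ?M = "x \<cdot>\<^sub>m 1\<^sub>m n - A"
  have M: "?M \<in> carrier_mat n n" using A by (rule minus_carrier_mat)
  obtain B where B: "mat_inverse ?M = Some B"
    and B': "?M * B = 1\<^sub>m n" "B * ?M = 1\<^sub>m n" "B \<in> carrier_mat n n"
    using mat_inverse_if_det_nonzero[OF M det] .
  have "B *\<^sub>v ones_vec n = y"
    using assoc_mult_mat_vec[OF B'(3) M y] y by (simp add: B'(2) eq)
  then have "coronal A x = ones_vec n \<bullet> y"
    using A B by (simp add: coronal_def Let_def)
  then show ?thesis
    using y by (simp add: ones_vec_def scalar_prod_def atLeast0LessThan)
qed

section \<open>Shifted characteristic matrices over the rational functions\<close>

lemma map_char_poly_matrix_eq: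
  fixes A :: "real mat"
  assumes "A \<in> carrier_mat n n"
  shows "map_mat to_fract (map_mat (\<lambda>p. p \<circ>\<^sub>p [:- c, 1:]) (char_poly_matrix A))
    = to_fract [:- c, 1:] \<cdot>\<^sub>m 1\<^sub>m n - map_mat (\<lambda>a. to_fract [:a:]) A"
proof (rule eq_matI)
  fix i j assume "i < dim_row (to_fract [:- c, 1:] \<cdot>\<^sub>m 1\<^sub>m n - map_mat (\<lambda>a. to_fract [:a:]) A)"
    and "j < dim_col (to_fract [:- c, 1:] \<cdot>\<^sub>m 1\<^sub>m n - map_mat (\<lambda>a. to_fract [:a:]) A)"
  then have ij: "i < n" "j < n" using assms by auto
  have "char_poly_matrix A $$ (i, j) \<circ>\<^sub>p [:- c, 1:] = (if i = j then [:- c, 1:] else 0) - [:A $$ (i, j):]"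
    using ij assms by (simp add: char_poly_matrix_def pcompose_pCons)
  then have "to_fract (char_poly_matrix A $$ (i, j) \<circ>\<^sub>p [:- c, 1:])
      = to_fract (if i = j then [:- c, 1:] else 0) - to_fract [:A $$ (i, j):]"
    by (simp only: to_fract_hom.hom_minus)
  then show "map_mat to_fract (map_mat (\<lambda>p. p \<circ>\<^sub>p [:- c, 1:]) (char_poly_matrix A)) $$ (i, j)
    = (to_fract [:- c, 1:] \<cdot>\<^sub>m 1\<^sub>m n - map_mat (\<lambda>a. to_fract [:a:]) A) $$ (i, j)"
    using ij assms by (simp add: char_poly_matrix_def)
qed (use assms in \<open>auto simp: char_poly_matrix_def\<close>)

text \<open>Composition with the shifted indeterminate and the embedding into the fraction field are
  ring homomorphisms, hence commute with the determinant that defines \<open>char_poly\<close>. This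
  also shows that the matrix inverted in \<open>coronal_fract\<close> has nonzero
  determinant.\<close>

lemma to_fract_char_poly:
  fixes A :: "real mat"
  assumes A: "A \<in> carrier_mat n n"
  shows "to_fract (char_poly A \<circ>\<^sub>p [:- c, 1:])
    = det (to_fract [:- c, 1:] \<cdot>\<^sub>m 1\<^sub>m n - map_mat (\<lambda>a. to_fract [:a:]) A)"
  unfolding map_char_poly_matrix_eq[OF A, symmetric] char_poly_def
  by (simp add: comm_ring_hom.hom_det[OF pcompose_hom.comm_ring_hom_axioms])

lemma char_poly_pcompose_nonzero:
  fixes A :: "real mat"
  assumes A: "A \<in> carrier_mat n n"
  shows "char_poly A \<circ>\<^sub>p [:- c, 1:] \<noteq> 0"
  using degree_monic_char_poly[OF A] pcompose_eq_0[of "char_poly A" "[:- c, 1:]"] by fastforce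

text \<open>Provides the solution vector that \<open>det_join\<close> asks for, together with the
  fact that its entries sum to the coronal.\<close>

lemma coronal_fract_obtain:
  assumes A: "A \<in> carrier_mat n n"
  obtains y where "y \<in> carrier_vec n"
    and "(to_fract [:- c, 1:] \<cdot>\<^sub>m 1\<^sub>m n - map_mat (\<lambda>a. to_fract [:a:]) A) *\<^sub>v y = ones_vec n"
    and "coronal_fract A c = (\<Sum>i<n. y $ i)"
proof -
  let ?M = "to_fract [:- c, 1:] \<cdot>\<^sub>m 1\<^sub>m n - map_mat (\<lambda>a. to_fract [:a:]) A"
  have M: "?M \<in> carrier_mat n n" using A by (intro minus_carrier_mat) simp
  have det: "det ?M \<noteq> 0"
    using to_fract_char_poly[OF A, of c] char_poly_pcompose_nonzero[OF A, of c] by auto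
  obtain B where B': "?M * B = 1\<^sub>m n" "B \<in> carrier_mat n n"
    using mat_inverse_if_det_nonzero[OF M det] by metis
  define y where "y = B *\<^sub>v ones_vec n"
  have y: "y \<in> carrier_vec n" using B' by (auto simp: y_def ones_vec_def)
  have "?M *\<^sub>v y = (?M * B) *\<^sub>v ones_vec n"
    unfolding y_def using B' M
    by (subst assoc_mult_mat_vec[of _ n n _ n]) (auto simp: ones_vec_def)
  then have eq: "?M *\<^sub>v y = ones_vec n" using B' by (simp add: ones_vec_def)
  have "coronal_fract A c = (\<Sum>i<n. y $ i)"
    unfolding coronal_fract_def
    by (rule coronal_eqI[OF _ y det eq]) (use A in simp)
  with y eq show ?thesis by (rule that)
qed

text \<open>This is the polynomial g_i of the statement when \<open>A\<close> is U_i and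
  \<open>c\<close> is \<delta> w_i.\<close>

definition main_poly :: "real mat \<Rightarrow> real \<Rightarrow> real poly" where
  "main_poly A c = (\<Prod>\<theta> | main_eigenvalue A \<theta>. [:- c - \<theta>, 1:])"

lemma main_eigenvalue_imp_eigenvalue: "main_eigenvalue A \<mu> \<Longrightarrow> eigenvalue A \<mu>"
  by (auto simp: main_eigenvalue_def eigenvalue_def)

lemma finite_eigenvalues:
  fixes A :: "real mat"
  assumes A: "A \<in> carrier_mat n n"
  shows "finite {\<mu>. eigenvalue A \<mu>}"
proof -
  have "char_poly A \<noteq> 0" using degree_monic_char_poly[OF A] by auto
  then show ?thesis unfolding eigenvalue_root_char_poly[OF A] by (rule poly_roots_finite)
qed

lemma finite_main_eigenvalues:
  assumes A: "A \<in> carrier_mat n n"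
  shows "finite {\<mu>. main_eigenvalue A \<mu>}"
  by (rule finite_subset[OF _ finite_eigenvalues[OF A]]) (auto dest: main_eigenvalue_imp_eigenvalue)

text \<open>\<open>A\<close> is similar to a diagonal matrix. Consequently the complex roots of the
  characteristic polynomial are just its real ones.\<close>

lemma real_symmetric_char_poly_splits:
  fixes A :: "real mat"
  assumes A: "A \<in> carrier_mat n n" and sym: "A\<^sup>T = A"
  shows "\<exists>as. char_poly A = (\<Prod>a\<leftarrow>as. [:- a, 1:])"
proof -
  obtain P D where P: "P \<in> carrier_mat n n" and D: "D \<in> carrier_mat n n" and diag: "diagonal_mat D"
    and PP: "P\<^sup>T * P = 1\<^sub>m n" and A_eq: "A = P * D * P\<^sup>T"
    using real_symmetric_diagonalization[OF A sym] by blast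
  have Pt: "P\<^sup>T \<in> carrier_mat n n" using P by simp
  have "similar_mat_wit A D P (P\<^sup>T)"
    by (rule similar_mat_witI[OF mat_mult_left_right_inverse[OF Pt P PP] PP A_eq A D P Pt])
  then have "char_poly A = char_poly D"
    by (intro char_poly_similar) (auto simp: similar_mat_def)
  also have "upper_triangular D" using diag D by (auto simp: diagonal_mat_def)
  then have "char_poly D = (\<Prod>a\<leftarrow>diag_mat D. [:- a, 1:])"
    by (rule char_poly_upper_triangular[OF D])
  finally show ?thesis by blast
qed

text \<open>In an orthonormal eigenbasis the coronal is a partial fraction sum whose poles are
  simple and lie at main eigenvalues, so \<open>main_poly\<close> clears them even if several
  eigenvectors share an eigenvalue. The numerators are squares and cannot cancel, which gives
  \<open>f \<noteq> 0\<close> and thereby a nonzero coronal.\<close>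

lemma coronal_main_poly:
  fixes A :: "real mat"
  assumes A: "A \<in> carrier_mat n n" and sym: "A\<^sup>T = A" and n: "n > 0"
  shows "\<exists>f. f \<noteq> 0 \<and> to_fract f = to_fract (main_poly A c) * coronal_fract A c"
proof -
  obtain P D where P: "P \<in> carrier_mat n n" and D: "D \<in> carrier_mat n n" and diag: "diagonal_mat D"
    and PP: "P\<^sup>T * P = 1\<^sub>m n" and A_eq: "A = P * D * P\<^sup>T"
    using real_symmetric_diagonalization[OF A sym] by blast
  have Pt: "P\<^sup>T \<in> carrier_mat n n" using P by simp
  have PP': "P * P\<^sup>T = 1\<^sub>m n" by (rule mat_mult_left_right_inverse[OF Pt P PP])
  \<comment> \<open>The \<open>b j\<close> are the eigenvalues belonging to the columns of
    \<open>P\<close>, and \<open>q j\<close> is the inner product of column \<open>j\<close> with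
    the all-ones vector.\<close>
  define b where "b j = D $$ (j, j)" for j
  define q where "q j = (\<Sum>i<n. P $$ (i, j))" for j
  define X where "X = to_fract [:- c, 1:]"
  \<comment> \<open>\<open>K\<close> embeds the real constants into the rational functions;
    \<open>X\<close> is the indeterminate already shifted by \<open>c\<close>.\<close>
  define K where "K = (\<lambda>a :: real. to_fract [:a:])"
  interpret K: inj_comm_ring_hom K
    by unfold_locales
      (auto simp: K_def simp flip: to_fract_hom.hom_add to_fract_hom.hom_mult)
  have Xb: "X - K a = to_fract [:- c - a, 1:]" for a
    by (simp add: X_def K_def flip: to_fract_hom.hom_minus)
  have Xb0: "X - K a \<noteq> 0" for a unfolding Xb by simp
  have AP: "A * P = P * D"
    unfolding A_eq using P D Pt PP by (simp add: assoc_mult_mat[of _ n n _ n _ n])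
  have APij: "(\<Sum>l<n. A $$ (i, l) * P $$ (l, j)) = P $$ (i, j) * b j" if ij: "i < n" "j < n" for i j
  proof -
    have "(\<Sum>l<n. A $$ (i, l) * P $$ (l, j)) = (A * P) $$ (i, j)"
      using A P ij by (simp add: scalar_prod_def atLeast0LessThan)
    also have "\<dots> = (\<Sum>l<n. P $$ (i, l) * D $$ (l, j))"
      unfolding AP using P D ij by (simp add: scalar_prod_def atLeast0LessThan)
    also have "\<dots> = (\<Sum>l<n. if l = j then P $$ (i, j) * b j else 0)"
      by (intro sum.cong refl) (use D ij diag in \<open>auto simp: b_def diagonal_mat_def\<close>)
    finally show ?thesis using ij by simp
  qed
  have PPij: "(\<Sum>j<n. P $$ (i, j) * P $$ (l, j)) = (if i = l then 1 else 0)"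
    if "i < n" "l < n" for i l
    using arg_cong[OF PP', of "\<lambda>M. M $$ (i, l)"] that P
    by (simp add: scalar_prod_def atLeast0LessThan)
  \<comment> \<open>The all-ones vector is expanded in the eigenbasis, where its coefficients are
    the \<open>q j\<close>.\<close>
  have Pq: "(\<Sum>j<n. P $$ (i, j) * q j) = 1" if "i < n" for i
  proof -
    have "(\<Sum>j<n. P $$ (i, j) * q j) = (\<Sum>l<n. \<Sum>j<n. P $$ (i, j) * P $$ (l, j))"
      unfolding q_def sum_distrib_left by (rule sum.swap)
    then show ?thesis using that by (simp add: PPij)
  qed
  \<comment> \<open>The witness inverts \<open>X - A\<close> on each eigencomponent of the all-ones
    vector, dividing component \<open>j\<close> by \<open>X - K (b j)\<close>.\<close>
  define y where "y = vec n (\<lambda>i. \<Sum>j<n. K (P $$ (i, j) * q j) / (X - K (b j)))"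
  have y: "y \<in> carrier_vec n" by (simp add: y_def)
  have eq: "(X \<cdot>\<^sub>m 1\<^sub>m n - map_mat K A) *\<^sub>v y = ones_vec n"
  proof (rule eq_vecI)
    fix i assume "i < dim_vec (ones_vec n :: real poly fract vec)"
    then have i: "i < n" by (simp add: ones_vec_def)
    have "((X \<cdot>\<^sub>m 1\<^sub>m n - map_mat K A) *\<^sub>v y) $ i
        = (\<Sum>l<n. (X * (if i = l then 1 else 0) - K (A $$ (i, l))) * y $ l)"
      using i A y by (simp add: scalar_prod_def atLeast0LessThan)
    also have "\<dots> = (\<Sum>l<n. if i = l then X * y $ l else 0) - (\<Sum>l<n. K (A $$ (i, l)) * y $ l)"
      unfolding sum_subtractf[symmetric] by (intro sum.cong) (auto simp: algebra_simps)
    also have "\<dots> = X * y $ i - (\<Sum>l<n. K (A $$ (i, l)) * y $ l)"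
      using i by simp
    also have "(\<Sum>l<n. K (A $$ (i, l)) * y $ l)
        = (\<Sum>j<n. K (\<Sum>l<n. A $$ (i, l) * P $$ (l, j)) * K (q j) / (X - K (b j)))"
      unfolding K.hom_sum sum_distrib_right sum_divide_distrib
      by (subst sum.swap) (auto simp: y_def sum_distrib_left K.hom_mult mult.assoc intro!: sum.cong)
    also have "X * y $ i - \<dots> = (\<Sum>j<n. K (P $$ (i, j) * q j))"
    proof -
      have *: "X * (k / (X - K a)) - K a * k / (X - K a) = k" for k a
        using Xb0[of a] by (simp add: left_diff_distrib[symmetric] diff_divide_distrib[symmetric])
      have "X * y $ i = (\<Sum>j<n. X * (K (P $$ (i, j) * q j) / (X - K (b j))))"
        using i by (simp add: y_def sum_distrib_left)
      moreover have "K (\<Sum>l<n. A $$ (i, l) * P $$ (l, j)) * K (q j) / (X - K (b j))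
          = K (b j) * K (P $$ (i, j) * q j) / (X - K (b j))" if "j < n" for j
        using i that by (simp add: APij K.hom_mult mult_ac)
      then have "(\<Sum>j<n. K (\<Sum>l<n. A $$ (i, l) * P $$ (l, j)) * K (q j) / (X - K (b j)))
          = (\<Sum>j<n. K (b j) * K (P $$ (i, j) * q j) / (X - K (b j)))"
        by (intro sum.cong) auto
      ultimately show ?thesis
        by (simp only: sum_subtractf[symmetric] *)
    qed
    also have "\<dots> = 1" using Pq[OF i] by (simp flip: K.hom_sum)
    finally show "((X \<cdot>\<^sub>m 1\<^sub>m n - map_mat K A) *\<^sub>v y) $ i = ones_vec n $ i"
      using i by (simp add: ones_vec_def)
  qed (use A in \<open>simp add: ones_vec_def\<close>)
  have det: "det (X \<cdot>\<^sub>m 1\<^sub>m n - map_mat K A) \<noteq> 0"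
    unfolding X_def K_def
    using to_fract_char_poly[OF A, of c] char_poly_pcompose_nonzero[OF A, of c] by auto
  have "coronal_fract A c = (\<Sum>i<n. y $ i)"
    using coronal_eqI[OF _ y det eq] A by (simp add: coronal_fract_def X_def K_def)
  \<comment> \<open>Summing column \<open>j\<close> of \<open>P\<close> produces a second factor
    \<open>q j\<close>, whence the squares.\<close>
  also have "\<dots> = (\<Sum>j<n. \<Sum>i<n. K (P $$ (i, j) * q j) / (X - K (b j)))"
    by (subst sum.swap) (simp add: y_def)
  also have "\<dots> = (\<Sum>j<n. K (q j * q j) / (X - K (b j)))"
    by (simp add: sum_divide_distrib[symmetric] q_def K.hom_sum[symmetric] sum_distrib_right)
  finally have \<Gamma>: "coronal_fract A c = (\<Sum>j<n. K (q j * q j) / (X - K (b j)))" .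
  define S where "S = {j. j < n \<and> q j \<noteq> 0}"
  have S: "finite S" by (simp add: S_def)
  let ?T = "{\<theta>. main_eigenvalue A \<theta>}"
  have T: "finite ?T" by (rule finite_main_eigenvalues[OF A])
  \<comment> \<open>Column \<open>j\<close> of \<open>P\<close> is itself the required eigenvector:
    its inner product with the all-ones vector is \<open>q j\<close>, which is nonzero on
    \<open>S\<close>.\<close>
  have main: "b j \<in> ?T" if "j \<in> S" for j
  proof -
    have j: "j < n" "q j \<noteq> 0" using that by (auto simp: S_def)
    have dot: "col P j \<bullet> ones_vec n = q j"
      using P j by (simp add: scalar_prod_def ones_vec_def q_def atLeast0LessThan)
    have "A *\<^sub>v col P j = b j \<cdot>\<^sub>v col P j"
      by (rule eq_vecI)
        (use A P j APij in \<open>auto simp: scalar_prod_def atLeast0LessThan mult.commute\<close>)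
    moreover have "col P j \<noteq> 0\<^sub>v n"
      using dot j by (auto simp: ones_vec_def)
    moreover have "col P j \<in> carrier_vec n" using P by (intro carrier_vecI) simp
    ultimately have "eigenvector A (col P j) (b j)"
      using A by (simp add: eigenvector_def)
    then show ?thesis using dot j A unfolding main_eigenvalue_def by auto
  qed
  \<comment> \<open>Multiplying a term by \<open>main_poly\<close> cancels its denominator against
    the factor for \<open>b j\<close>, leaving the product over the other main eigenvalues.\<close>
  define f where "f = (\<Sum>j\<in>S. Polynomial.smult (q j * q j) (\<Prod>\<theta>\<in>?T - {b j}. [:- c - \<theta>, 1:]))"
  have "to_fract (main_poly A c) * coronal_fract A c
      = (\<Sum>j<n. to_fract (main_poly A c) * (K (q j * q j) / (X - K (b j))))"
    unfolding \<Gamma> by (rule sum_distrib_left)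
  also have "\<dots> = (\<Sum>j\<in>S. to_fract (main_poly A c) * (K (q j * q j) / (X - K (b j))))"
    by (rule sum.mono_neutral_right) (auto simp: S_def)
  also have "\<dots> = (\<Sum>j\<in>S. to_fract (Polynomial.smult (q j * q j) (\<Prod>\<theta>\<in>?T - {b j}. [:- c - \<theta>, 1:])))"
  proof (rule sum.cong[OF refl])
    fix j assume j: "j \<in> S"
    have "main_poly A c = [:- c - b j, 1:] * (\<Prod>\<theta>\<in>?T - {b j}. [:- c - \<theta>, 1:])"
      unfolding main_poly_def by (rule prod.remove[OF T main[OF j]])
    then have "to_fract (main_poly A c)
        = (X - K (b j)) * to_fract (\<Prod>\<theta>\<in>?T - {b j}. [:- c - \<theta>, 1:])"
      unfolding Xb by (simp only: to_fract_hom.hom_mult)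
    moreover have "Polynomial.smult a p = [:a:] * p" for a :: real and p by simp
    ultimately show "to_fract (main_poly A c) * (K (q j * q j) / (X - K (b j)))
        = to_fract (Polynomial.smult (q j * q j) (\<Prod>\<theta>\<in>?T - {b j}. [:- c - \<theta>, 1:]))"
      using Xb0[of "b j"] by (simp only: to_fract_hom.hom_mult K_def) simp
  qed
  also have "\<dots> = to_fract f" unfolding f_def to_fract_hom.hom_sum ..
  finally have "to_fract f = to_fract (main_poly A c) * coronal_fract A c" ..
  moreover have "f \<noteq> 0"
  proof -
    \<comment> \<open>To the right of all its poles the coronal is a sum of positive terms.\<close>
    define t where "t = c + Max (insert 0 ?T) + 1"
    have t: "t - c - \<theta> > 0" if "\<theta> \<in> ?T" for \<theta>
    proof -
      have "\<theta> \<le> Max (insert 0 ?T)" by (rule Max_ge) (use T that in auto)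
      then show ?thesis unfolding t_def by linarith
    qed
    \<comment> \<open>If every \<open>q j\<close> vanished, the expansion \<open>Pq\<close> in row 0
      would read 0 = 1.\<close>
    have "S \<noteq> {}"
    proof
      assume "S = {}"
      then have "q j = 0" if "j < n" for j using that by (auto simp: S_def)
      then show False using Pq[OF n] by simp
    qed
    moreover have "poly (Polynomial.smult (q j * q j) (\<Prod>\<theta>\<in>?T - {b j}. [:- c - \<theta>, 1:])) t > 0"
      if "j \<in> S" for j
    proof -
      have "q j * q j > 0"
        using that by (auto simp: S_def zero_less_mult_iff linorder_neq_iff)
      moreover have "(\<Prod>\<theta>\<in>?T - {b j}. poly [:- c - \<theta>, 1:] t) > 0"
        by (rule prod_pos) (use t in force)
      ultimately show ?thesis by (simp add: poly_prod)
    qed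
    ultimately have "poly f t > 0"
      unfolding f_def poly_sum using S by (intro sum_pos)
    then show ?thesis by auto
  qed
  ultimately show ?thesis by blast
qed

section \<open>Multisets of eigenvalues\<close>

interpretation of_real_poly_hom: map_poly_inj_idom_hom complex_of_real ..

lemma pcompose_prod_list_shift:
  fixes as :: "'a :: comm_ring_1 list"
  shows "(\<Prod>a\<leftarrow>as. [:- a, 1:]) \<circ>\<^sub>p [:- c, 1:] = (\<Prod>a\<leftarrow>as. [:- (a + c), 1:])"
proof (induction as)
  case (Cons a as)
  have "[:- a, 1:] \<circ>\<^sub>p [:- c, 1:] = [:- (a + c), 1:]" by (simp add: pcompose_pCons)
  with Cons show ?case by (simp only: list.map prod_list.Cons pcompose_mult)
qed (simp add: pcompose_1)

lemma proots_linear_factors: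
  fixes as :: "'a :: idom list"
  shows "proots (\<Prod>a\<leftarrow>as. [:- f a, 1:]) = image_mset f (mset as)"
proof (induction as)
  case (Cons a as)
  have "(\<Prod>a\<leftarrow>as. [:- f a, 1:]) \<noteq> 0" by (auto simp: prod_list_zero_iff)
  then have "proots ([:- f a, 1:] * (\<Prod>a\<leftarrow>as. [:- f a, 1:]))
      = {#f a#} + proots (\<Prod>a\<leftarrow>as. [:- f a, 1:])"
    using proots_linear_factor[of "- f a"] by (subst proots_mult) auto
  with Cons show ?case by simp
qed simp

lemma map_poly_of_real_linear_factors:
  "map_poly complex_of_real (\<Prod>a\<leftarrow>as. [:- f a, 1:]) = (\<Prod>a\<leftarrow>as. [:- of_real (f a), 1:])"
proof (induction as)
  case (Cons a as)
  then show ?case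
    by (simp only: list.map prod_list.Cons of_real_poly_hom.hom_mult) simp
qed simp

text \<open>Puts a multiset of roots into the form of replicated eigenvalues used in the final
  statement. Elements of \<open>S\<close> outside \<open>M\<close> have count 0 and contribute
  nothing.\<close>

lemma image_mset_conv_sum_replicate:
  assumes "finite S" and "set_mset M \<subseteq> S"
  shows "image_mset h M = (\<Sum>a\<in>S. replicate_mset (count M a) (h a))"
  using assms(2)
proof (induction M)
  case empty
  then show ?case by simp
next
  case (add x M)
  have "(\<Sum>a\<in>S. replicate_mset (count (add_mset x M) a) (h a))
      = (\<Sum>a\<in>S. replicate_mset (count M a) (h a) + (if a = x then {#h a#} else {#}))"
    by (intro sum.cong) auto
  also have "\<dots> = image_mset h (add_mset x M)"
    using add assms(1) by (simp add: sum.distrib)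
  finally show ?case ..
qed

text \<open>The characteristic polynomial splits over the reals, and the composition moves each root
  \<mu> to \<mu> + c with its order, so no complex roots are left to account for.\<close>

lemma proots_shifted_char_poly:
  fixes A :: "real mat"
  assumes A: "A \<in> carrier_mat n n" and sym: "A\<^sup>T = A"
  shows "proots (map_poly complex_of_real (char_poly A \<circ>\<^sub>p [:- c, 1:]))
    = (\<Sum>\<mu> | eigenvalue A \<mu>. replicate_mset (Polynomial.order \<mu> (char_poly A)) (of_real (\<mu> + c)))"
proof -
  obtain as where as: "char_poly A = (\<Prod>a\<leftarrow>as. [:- a, 1:])"
    using real_symmetric_char_poly_splits[OF A sym] by blast
  have nz: "char_poly A \<noteq> 0" using degree_monic_char_poly[OF A] by auto
  have mset: "mset as = proots (char_poly A)"
    unfolding as using proots_linear_factors[of "\<lambda>a. a" as] by simp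
  have "proots (map_poly complex_of_real (char_poly A \<circ>\<^sub>p [:- c, 1:]))
      = image_mset (\<lambda>a. of_real (a + c)) (proots (char_poly A))"
    unfolding as pcompose_prod_list_shift map_poly_of_real_linear_factors
    unfolding proots_linear_factors as[symmetric] mset ..
  also have "\<dots> = (\<Sum>\<mu> | eigenvalue A \<mu>.
      replicate_mset (count (proots (char_poly A)) \<mu>) (of_real (\<mu> + c)))"
    by (rule image_mset_conv_sum_replicate)
      (use nz finite_eigenvalues[OF A] in \<open>auto simp: eigenvalue_root_char_poly[OF A]\<close>)
  finally show ?thesis using nz by simp
qed

lemma proots_main_poly:
  assumes A: "A \<in> carrier_mat n n"
  shows "proots (map_poly complex_of_real (main_poly A c))
    = (\<Sum>\<theta> | main_eigenvalue A \<theta>. {#complex_of_real (\<theta> + c)#})"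
proof -
  have "map_poly complex_of_real (main_poly A c)
      = (\<Prod>\<theta> | main_eigenvalue A \<theta>. [:- complex_of_real (\<theta> + c), 1:])"
    unfolding main_poly_def of_real_poly_hom.hom_prod by (intro prod.cong refl) simp
  moreover have "proots [:- complex_of_real (\<theta> + c), 1:] = {#complex_of_real (\<theta> + c)#}" for \<theta>
    using proots_linear_factor[of "- complex_of_real (\<theta> + c)"] by simp
  ultimately show ?thesis
    by (simp only:) (subst proots_prod, auto)
qed

lemma main_poly_nonzero:
  assumes "A \<in> carrier_mat n n"
  shows "main_poly A c \<noteq> 0"
  using finite_main_eigenvalues[OF assms] by (simp add: main_poly_def)

text \<open>One copy of each main eigenvalue is set aside; for \<open>h \<mu>\<close> equal to the
  shifted eigenvalue these copies are the roots of \<open>main_poly\<close>, which will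
  cancel.\<close>

lemma spectrum_split:
  fixes A :: "real mat"
  assumes A: "A \<in> carrier_mat n n"
  shows "(\<Sum>\<mu> | eigenvalue A \<mu>. replicate_mset (Polynomial.order \<mu> (char_poly A)) (h \<mu>))
    = (\<Sum>\<mu> | eigenvalue A \<mu> \<and> \<not> main_eigenvalue A \<mu>. replicate_mset (Polynomial.order \<mu> (char_poly A)) (h \<mu>))
      + (\<Sum>\<mu> | main_eigenvalue A \<mu>. replicate_mset (Polynomial.order \<mu> (char_poly A) - 1) (h \<mu>))
      + (\<Sum>\<mu> | main_eigenvalue A \<mu>. {#h \<mu>#})"
proof -
  have nz: "char_poly A \<noteq> 0" using degree_monic_char_poly[OF A] by auto
  have split: "{\<mu>. eigenvalue A \<mu>}
      = {\<mu>. eigenvalue A \<mu> \<and> \<not> main_eigenvalue A \<mu>} \<union> {\<mu>. main_eigenvalue A \<mu>}"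
    using main_eigenvalue_imp_eigenvalue by blast
  have "replicate_mset (Polynomial.order \<mu> (char_poly A)) (h \<mu>)
      = replicate_mset (Polynomial.order \<mu> (char_poly A) - 1) (h \<mu>) + {#h \<mu>#}" if "main_eigenvalue A \<mu>" for \<mu>
  proof -
    \<comment> \<open>The order is positive, so the truncated subtraction of 1 is a genuine
      one.\<close>
    have "Polynomial.order \<mu> (char_poly A) \<noteq> 0"
      using main_eigenvalue_imp_eigenvalue[OF that] nz
      by (simp add: eigenvalue_root_char_poly[OF A] order_root)
    then show ?thesis by (cases "Polynomial.order \<mu> (char_poly A)") auto
  qed
  then have "(\<Sum>\<mu> | main_eigenvalue A \<mu>. replicate_mset (Polynomial.order \<mu> (char_poly A)) (h \<mu>))
      = (\<Sum>\<mu> | main_eigenvalue A \<mu>. replicate_mset (Polynomial.order \<mu> (char_poly A) - 1) (h \<mu>) + {#h \<mu>#})"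
    by (intro sum.cong) auto
  moreover have "finite {\<mu>. eigenvalue A \<mu> \<and> \<not> main_eigenvalue A \<mu>}"
    using finite_eigenvalues[OF A] by simp
  ultimately show ?thesis
    unfolding split using finite_main_eigenvalues[OF A]
    by (subst sum.union_disjoint) (auto simp only: sum.distrib add.assoc)
qed

section \<open>Universal matrices of joins\<close>

definition universal_entry ::
  "real \<Rightarrow> real \<Rightarrow> real \<Rightarrow> real \<Rightarrow> 'a pair_pre_digraph \<Rightarrow> 'a \<Rightarrow> 'a \<Rightarrow> real" where
  "universal_entry \<alpha> \<beta> \<gamma> \<delta> G x y = \<alpha> * (if (x, y) \<in> parcs G then 1 else 0) + \<gamma>
     + (if x = y then \<beta> + \<delta> * real (card {z. (x, z) \<in> parcs G}) else 0)"

lemma universal_matrix_conv_list_mat: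
  assumes "distinct L"
  shows "universal_matrix \<alpha> \<beta> \<gamma> \<delta> G L = list_mat L (universal_entry \<alpha> \<beta> \<gamma> \<delta> G)"
  by (rule eq_matI)
    (use assms in \<open>auto simp: universal_matrix_def adjacency_matrix_def degree_matrix_def
      universal_entry_def nth_eq_iff_index_eq\<close>)

lemma to_fract_char_poly_list_mat:
  fixes F :: "'v \<Rightarrow> 'v \<Rightarrow> real"
  assumes "distinct L"
  shows "to_fract (char_poly (list_mat L F) \<circ>\<^sub>p [:- c, 1:])
    = det (list_mat L (\<lambda>a b. (if a = b then to_fract [:- c, 1:] else 0) - to_fract [:F a b:]))"
proof -
  have "to_fract [:- c, 1:] \<cdot>\<^sub>m 1\<^sub>m (length L) - map_mat (\<lambda>a. to_fract [:a:]) (list_mat L F)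
      = list_mat L (\<lambda>a b. (if a = b then to_fract [:- c, 1:] else 0) - to_fract [:F a b:])"
    by (rule eq_matI) (use assms in \<open>auto simp: nth_eq_iff_index_eq\<close>)
  then show ?thesis unfolding to_fract_char_poly[OF list_mat_carrier] by simp
qed

text \<open>Carries the solution vector over from positions to vertices, the form in which
  \<open>det_join\<close> uses it. The position of a vertex is unique because \<open>L\<close> is
  distinct.\<close>

lemma coronal_fract_list_mat:
  fixes F :: "'v \<Rightarrow> 'v \<Rightarrow> real"
  assumes L: "distinct L"
  obtains s where "\<And>x. x \<in> set L \<Longrightarrow>
      (\<Sum>y\<in>set L. ((if x = y then to_fract [:- c, 1:] else 0) - to_fract [:F x y:]) * s y) = 1"
    and "coronal_fract (list_mat L F) c = (\<Sum>y\<in>set L. s y)"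
proof -
  obtain y where y: "y \<in> carrier_vec (length L)"
    and eq: "(to_fract [:- c, 1:] \<cdot>\<^sub>m 1\<^sub>m (length L)
        - map_mat (\<lambda>a. to_fract [:a:]) (list_mat L F)) *\<^sub>v y = ones_vec (length L)"
    and cor: "coronal_fract (list_mat L F) c = (\<Sum>i<length L. y $ i)"
    using coronal_fract_obtain[OF list_mat_carrier] .
  define s where "s x = y $ (THE i. i < length L \<and> L ! i = x)" for x
  have s: "s (L ! i) = y $ i" if "i < length L" for i
  proof -
    have "(THE j. j < length L \<and> L ! j = L ! i) = i"
      by (rule the_equality) (use that L in \<open>auto simp: nth_eq_iff_index_eq\<close>)
    then show ?thesis by (simp add: s_def)
  qed
  show ?thesis
  proof (rule that)
    fix x assume "x \<in> set L"
    then obtain i where i: "i < length L" "x = L ! i" by (auto simp: in_set_conv_nth)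
    have "1 = ones_vec (length L) $ i" using i by (simp add: ones_vec_def)
    also have "\<dots> = (\<Sum>j<length L. ((if i = j then to_fract [:- c, 1:] else 0)
        - to_fract [:F (L ! i) (L ! j):]) * y $ j)"
      unfolding eq[symmetric] using i y
      by (auto simp: scalar_prod_def atLeast0LessThan intro!: sum.cong)
    also have "\<dots> = (\<Sum>j<length L. ((if L ! i = L ! j then to_fract [:- c, 1:] else 0)
        - to_fract [:F (L ! i) (L ! j):]) * s (L ! j))"
      using i L by (intro sum.cong) (auto simp: s nth_eq_iff_index_eq)
    also have "\<dots> = (\<Sum>y\<in>set L. ((if x = y then to_fract [:- c, 1:] else 0) - to_fract [:F x y:]) * s y)"
      unfolding i(2) by (rule sum_nth_distinct[OF L])
    finally show "(\<Sum>y\<in>set L. ((if x = y then to_fract [:- c, 1:] else 0) - to_fract [:F x y:]) * s y) = 1" ..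
  next
    show "coronal_fract (list_mat L F) c = (\<Sum>y\<in>set L. s y)"
      unfolding cor sum_nth_distinct[OF L, symmetric] by (simp add: s)
  qed
qed

text \<open>A vertex is adjacent to its neighbours inside its own part and to everything in the
  parts adjacent to it. These sets are disjoint because \<open>H\<close> has no loops. The sum is
  the source of w_i.\<close>

lemma card_neighbours_hjoin:
  assumes H: "pair_graph H" and G: "\<And>u. u \<in> pverts H \<Longrightarrow> pair_graph (G u)"
    and u: "u \<in> pverts H" and x: "x \<in> pverts (G u)"
  shows "card {z. ((u, x), z) \<in> parcs (hjoin H G)}
    = card {y. (x, y) \<in> parcs (G u)} + (\<Sum>l | (u, l) \<in> parcs H. card (pverts (G l)))"
proof -
  interpret H: pair_graph H by (rule H)
  interpret Gu: pair_graph "G u" by (rule G[OF u])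
  let ?N = "{l. (u, l) \<in> parcs H}"
  have N: "?N \<subseteq> pverts H" by (auto dest: H.in_arcsD2)
  have finN: "finite ?N" using N by (rule finite_subset) simp
  have finV: "finite (pverts (G l))" if "l \<in> ?N" for l
  proof -
    interpret Gl: pair_graph "G l" by (rule G) (use N that in auto)
    show ?thesis by simp
  qed
  have finx: "finite {y. (x, y) \<in> parcs (G u)}"
    by (rule finite_subset[OF _ Gu.pair_finite_verts]) (auto dest: Gu.in_arcsD2)
  have loop: "(u, u) \<notin> parcs H" using H.pair_no_loops by fastforce
  have "{z. ((u, x), z) \<in> parcs (hjoin H G)}
      = Pair u ` {y. (x, y) \<in> parcs (G u)} \<union> (SIGMA l : ?N. pverts (G l))"
    using u x by (auto simp: hjoin_def)
  also have "card \<dots> = card (Pair u ` {y. (x, y) \<in> parcs (G u)}) + card (SIGMA l : ?N. pverts (G l))"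
    by (rule card_Un_disjoint) (use loop finN finV finx in auto)
  also have "\<dots> = card {y. (x, y) \<in> parcs (G u)} + (\<Sum>l\<in>?N. card (pverts (G l)))"
    using finN finV by (subst card_image) (auto simp: inj_on_def)
  finally show ?thesis .
qed

text \<open>Loop-freeness of \<open>H\<close> lets arcs within a part come from \<open>G u\<close>
  alone, so a diagonal block differs from the matrix of \<open>G u\<close> only by the degree shift
  \<delta> w_u. Between different parts the entry is constant, which is what \<open>det_join\<close>
  exploits.\<close>

lemma universal_entry_hjoin:
  assumes H: "pair_graph H" and G: "\<And>u. u \<in> pverts H \<Longrightarrow> pair_graph (G u)"
    and "u \<in> pverts H" "x \<in> pverts (G u)" "v \<in> pverts H" "y \<in> pverts (G v)"
  shows "universal_entry \<alpha> \<beta> \<gamma> \<delta> (hjoin H G) (u, x) (v, y)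
    = (if u = v then universal_entry \<alpha> \<beta> \<gamma> \<delta> (G u) x y
         + (if x = y then \<delta> * real (\<Sum>l | (u, l) \<in> parcs H. card (pverts (G l))) else 0)
       else \<alpha> * (if (u, v) \<in> parcs H then 1 else 0) + \<gamma>)"
proof -
  interpret H: pair_graph H by (rule H)
  have "(u, u) \<notin> parcs H" using H.pair_no_loops by fastforce
  then have "((u, x), (v, y)) \<in> parcs (hjoin H G)
      \<longleftrightarrow> (if u = v then (x, y) \<in> parcs (G u) else (u, v) \<in> parcs H)"
    using assms(3-) by (auto simp: hjoin_def)
  then show ?thesis
    using card_neighbours_hjoin[of H G u x] assms
    by (auto simp: universal_entry_def algebra_simps)
qed

lemma transpose_universal_matrix:
  assumes G: "pair_graph G" and L: "distinct L"
  shows "(universal_matrix \<alpha> \<beta> \<gamma> \<delta> G L)\<^sup>T = universal_matrix \<alpha> \<beta> \<gamma> \<delta> G L"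
proof -
  interpret pair_graph G by (rule G)
  have "(x, y) \<in> parcs G \<longleftrightarrow> (y, x) \<in> parcs G" for x y
    using pair_sym_arcs by (auto simp: symmetric_def dest: symD)
  then show ?thesis
    unfolding universal_matrix_conv_list_mat[OF L]
    by (intro eq_matI) (auto simp: universal_entry_def)
qed

theorem theorem4p2:
  fixes H :: "'h pair_pre_digraph"
    and G :: "'h \<Rightarrow> 'a pair_pre_digraph"
    and vs :: "'h list"
    and xs :: "'h \<Rightarrow> 'a list"
    and \<alpha> \<beta> \<gamma> \<delta> :: real
  defines "k \<equiv> length vs"
    and "n \<equiv> \<lambda>u. card (pverts (G u))"
    and "UG \<equiv> universal_matrix \<alpha> \<beta> \<gamma> \<delta> (hjoin H G) (hjoin_order vs xs)"
    and "U \<equiv> \<lambda>u. universal_matrix \<alpha> \<beta> \<gamma> \<delta> (G u) (xs u)"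
  defines "w \<equiv> \<lambda>u. real (\<Sum>l | (u, l) \<in> parcs H. n l)"
    and "\<rho> \<equiv> \<lambda>i j. \<alpha> * (if (vs ! i, vs ! j) \<in> parcs H then 1 else 0) + \<gamma>"
  defines "\<phi> \<equiv> \<lambda>u. char_poly (U u) \<circ>\<^sub>p [:- (\<delta> * w u), 1:]"
    and "\<Gamma> \<equiv> \<lambda>u. coronal_fract (U u) (\<delta> * w u)"
    and "g \<equiv> \<lambda>u. \<Prod>\<theta> | main_eigenvalue (U u) \<theta>. [:- (\<delta> * w u) - \<theta>, 1:]"
  defines "\<Phi> \<equiv> \<lambda>f :: 'h \<Rightarrow> real poly.
      det (mat k k (\<lambda>(i, j). if i = j then g (vs ! i) else - Polynomial.smult (\<rho> i j) (f (vs ! i))))"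
  assumes "pair_graph H"
    and "distinct vs" and "set vs = pverts H"
    and "\<And>u. u \<in> pverts H \<Longrightarrow> pair_graph (G u)"
    and "\<And>u. u \<in> pverts H \<Longrightarrow> pverts (G u) \<noteq> {}"
    and "\<And>u. u \<in> pverts H \<Longrightarrow> distinct (xs u)"
    and "\<And>u. u \<in> pverts H \<Longrightarrow> set (xs u) = pverts (G u)"
    and "\<alpha> \<noteq> 0"
  shows "(to_fract (char_poly UG) =
      (\<Prod>u\<in>pverts H. to_fract (\<phi> u) * \<Gamma> u) *
      det (mat k k (\<lambda>(i, j). if i = j then 1 / \<Gamma> (vs ! i) else - to_fract [:\<rho> i j:])))
    \<and> (\<exists>f :: 'h \<Rightarrow> real poly.
      (\<forall>u\<in>pverts H. to_fract (f u) = to_fract (g u) * \<Gamma> u) \<and>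
      spectrum_mset UG =
        (\<Sum>u\<in>pverts H.
           (\<Sum>\<mu> | eigenvalue (U u) \<mu> \<and> \<not> main_eigenvalue (U u) \<mu>.
              replicate_mset (Polynomial.order \<mu> (char_poly (U u))) (complex_of_real (\<mu> + \<delta> * w u))) +
           (\<Sum>\<mu> | main_eigenvalue (U u) \<mu>.
              replicate_mset (Polynomial.order \<mu> (char_poly (U u)) - 1) (complex_of_real (\<mu> + \<delta> * w u)))) +
        proots (map_poly complex_of_real (\<Phi> f)))"
proof -
  note H = assms(11) and vs = assms(12) and svs = assms(13) and G = assms(14)
    and ne = assms(15) and xs = assms(16) and sxs = assms(17)
  define c where "c u = \<delta> * w u" for u
  define r where "r u v = \<alpha> * (if (u, v) \<in> parcs H then 1 else 0) + \<gamma>" for u v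
  define L where "L = hjoin_order vs xs"
  \<comment> \<open>These are the entries of X - \<delta> w_u - U_u, the diagonal blocks of X -
    U(G).\<close>
  define m where "m u x y = (if x = y then to_fract [:- c u, 1:] else 0)
    - to_fract [:universal_entry \<alpha> \<beta> \<gamma> \<delta> (G u) x y:]" for u x y
  have L: "distinct L" "set L = (SIGMA u : pverts H. pverts (G u))"
    using distinct_hjoin_order[OF vs, of xs] xs svs sxs by (auto simp: L_def set_hjoin_order)
  have U: "U u = list_mat (xs u) (universal_entry \<alpha> \<beta> \<gamma> \<delta> (G u))" if "u \<in> pverts H" for u
    unfolding U_def by (rule universal_matrix_conv_list_mat[OF xs[OF that]])
  have Uc: "U u \<in> carrier_mat (length (xs u)) (length (xs u))" if "u \<in> pverts H" for u
    by (simp add: U[OF that])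
  have Usym: "(U u)\<^sup>T = U u" if "u \<in> pverts H" for u
    unfolding U_def by (rule transpose_universal_matrix[OF G[OF that] xs[OF that]])
  have len: "length (xs u) > 0" if "u \<in> pverts H" for u
    using ne[OF that] sxs[OF that] by auto
  have UG: "UG = list_mat L (universal_entry \<alpha> \<beta> \<gamma> \<delta> (hjoin H G))"
    unfolding UG_def L_def[symmetric] by (rule universal_matrix_conv_list_mat[OF L(1)])
  have UGc: "UG \<in> carrier_mat (length L) (length L)" by (simp add: UG)
  have finH: "finite (pverts H)" using svs by (metis finite_set)

  \<comment> \<open>Determinants, coronals and solution vectors of the parts\<close>
  have \<phi>: "to_fract (\<phi> u) = det (list_mat (xs u) (m u))" if "u \<in> pverts H" for u
    unfolding \<phi>_def U[OF that] m_def c_def by (rule to_fract_char_poly_list_mat[OF xs[OF that]])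
  have "\<exists>f. f \<noteq> 0 \<and> to_fract f = to_fract (g u) * \<Gamma> u" if "u \<in> pverts H" for u
    using coronal_main_poly[OF Uc[OF that] Usym[OF that] len[OF that], of "\<delta> * w u"]
    unfolding main_poly_def g_def \<Gamma>_def .
  then obtain f where f0: "\<And>u. u \<in> pverts H \<Longrightarrow> f u \<noteq> 0"
    and f: "\<And>u. u \<in> pverts H \<Longrightarrow> to_fract (f u) = to_fract (g u) * \<Gamma> u"
    by metis
  \<comment> \<open>Since \<open>f u\<close> is nonzero, so is the coronal; hence 1/\<Gamma> is a
    true inverse and not the default value of division by zero.\<close>
  have \<Gamma>0: "\<Gamma> u \<noteq> 0" if "u \<in> pverts H" for u
    using f[OF that] f0[OF that] by auto
  have "\<exists>s. (\<forall>x\<in>set (xs u). (\<Sum>y\<in>set (xs u). m u x y * s y) = 1) \<and> \<Gamma> u = (\<Sum>y\<in>set (xs u). s y)"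
    if "u \<in> pverts H" for u
    unfolding \<Gamma>_def U[OF that] m_def c_def
    by (rule coronal_fract_list_mat[OF xs[OF that],
          of "\<delta> * w u" "universal_entry \<alpha> \<beta> \<gamma> \<delta> (G u)"]) blast
  then obtain s where s: "\<And>u x. u \<in> pverts H \<Longrightarrow> x \<in> set (xs u) \<Longrightarrow>
      (\<Sum>y\<in>set (xs u). m u x y * s u y) = 1"
    and \<Gamma>: "\<And>u. u \<in> pverts H \<Longrightarrow> \<Gamma> u = (\<Sum>y\<in>set (xs u). s u y)"
    by metis

  \<comment> \<open>The characteristic polynomial of the join, claim (i)\<close>
  let ?E = "\<lambda>u v. if u = v then 1 / \<Gamma> u else - to_fract [:r u v:]"
  \<comment> \<open>The trivial shift by 0 brings the polynomial into the shape of
    \<open>to_fract_char_poly_list_mat\<close>.\<close>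
  have "to_fract (char_poly UG) = to_fract (char_poly UG \<circ>\<^sub>p [:- 0, 1:])"
    by (simp only: minus_zero pcompose_idR)
  also have "\<dots> = det (list_mat L (\<lambda>(u, x) (v, y). if u = v then m u x y else - to_fract [:r u v:]))"
    unfolding UG to_fract_char_poly_list_mat[OF L(1)]
  proof (rule arg_cong[of _ _ det], rule list_mat_cong)
    fix a b assume ab: "a \<in> set L" "b \<in> set L"
    obtain u x v y where [simp]: "a = (u, x)" "b = (v, y)" by (cases a, cases b)
    from ab have mem: "u \<in> pverts H" "x \<in> pverts (G u)" "v \<in> pverts H" "y \<in> pverts (G v)"
      by (auto simp: L(2))
    \<comment> \<open>The degree contributed by the other parts moves from the matrix entry into the
      shift of the indeterminate.\<close>
    have *: "to_fract [:0, 1:] - to_fract [:e + c u:] = to_fract [:- c u, 1:] - to_fract [:e:]"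
      for e by (simp flip: to_fract_hom.hom_minus)
    show "(if a = b then to_fract [:- 0, 1:] else 0)
        - to_fract [:universal_entry \<alpha> \<beta> \<gamma> \<delta> (hjoin H G) a b:]
      = (case a of (u, x) \<Rightarrow> \<lambda>(v, y). if u = v then m u x y else - to_fract [:r u v:]) b"
      using universal_entry_hjoin[of H G u x v y \<alpha> \<beta> \<gamma> \<delta>] H G mem *
      by (auto simp: m_def r_def c_def w_def n_def)
  qed
  also have "\<dots> = (\<Prod>u\<in>pverts H. det (list_mat (xs u) (m u))) *
      det (list_mat vs (\<lambda>u v. if u = v then 1
        else - to_fract [:r u v:] * (\<Sum>y\<in>set (xs v). s v y)))"
    unfolding L_def svs[symmetric] by (rule det_join[OF vs]) (use svs xs s in auto)
  \<comment> \<open>Column \<open>v\<close> is divisible by \<open>\<Gamma> v\<close>, the diagonal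
    1 being written as (1/\<Gamma>) \<Gamma>.\<close>
  also have "list_mat vs (\<lambda>u v. if u = v then 1 else - to_fract [:r u v:] * (\<Sum>y\<in>set (xs v). s v y))
      = list_mat vs (\<lambda>u v. ?E u v * \<Gamma> v)"
    by (rule list_mat_cong) (use svs \<Gamma> \<Gamma>0 in auto)
  also have "det \<dots> = (\<Prod>u\<in>pverts H. \<Gamma> u) * det (list_mat vs ?E)"
    using det_list_mat_scale_columns[OF vs, of ?E \<Gamma>] svs by simp
  finally have main: "to_fract (char_poly UG)
      = (\<Prod>u\<in>pverts H. to_fract (\<phi> u) * \<Gamma> u) * det (list_mat vs ?E)"
    by (simp add: prod.distrib \<phi> mult.assoc)
  have E: "mat k k (\<lambda>(i, j). if i = j then 1 / \<Gamma> (vs ! i) else - to_fract [:\<rho> i j:]) = list_mat vs ?E"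
    by (rule eq_matI) (auto simp: k_def \<rho>_def r_def nth_eq_iff_index_eq[OF vs])

  \<comment> \<open>Clearing denominators with \<Phi>\<close>
  have "to_fract (\<Phi> f) = det (list_mat vs (\<lambda>u v. to_fract (f u) * ?E u v))"
    unfolding \<Phi>_def to_fract_hom.hom_det[symmetric]
  proof (rule arg_cong[of _ _ det], rule eq_matI)
    fix i j assume "i < dim_row (list_mat vs (\<lambda>u v. to_fract (f u) * ?E u v))"
      and "j < dim_col (list_mat vs (\<lambda>u v. to_fract (f u) * ?E u v))"
    then have ij: "i < length vs" "j < length vs" by auto
    then have mem: "vs ! i \<in> pverts H" using nth_mem[OF ij(1)] svs by simp
    have smult: "to_fract (- Polynomial.smult a p) = to_fract p * - to_fract [:a:]" for a :: real and p
    proof -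
      have "Polynomial.smult a p = [:a:] * p" by simp
      then show ?thesis by (simp only: to_fract_hom.hom_uminus to_fract_hom.hom_mult) (simp add: mult.commute)
    qed
    show "map_mat to_fract (mat k k (\<lambda>(i, j). if i = j then g (vs ! i)
          else - Polynomial.smult (\<rho> i j) (f (vs ! i)))) $$ (i, j)
        = list_mat vs (\<lambda>u v. to_fract (f u) * ?E u v) $$ (i, j)"
    proof (cases "i = j")
      case True
      then show ?thesis using ij f[OF mem] \<Gamma>0[OF mem] by (simp add: k_def)
    next
      case False
      then have "vs ! i \<noteq> vs ! j" using nth_eq_iff_index_eq[OF vs ij] by simp
      with False show ?thesis
        using ij smult[of "\<rho> i j" "f (vs ! i)"] by (simp only: list_mat_index)
          (simp add: k_def \<rho>_def r_def)
    qed
  qed (simp_all add: k_def)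
  \<comment> \<open>Row \<open>u\<close> of \<open>?E\<close> has been scaled by \<open>f u\<close>,
    which equals \<open>g u\<close> times \<open>\<Gamma> u\<close>. The \<Gamma> factors reappear
    in \<open>main\<close>, so multiplying \<open>main\<close> by the product of the
    \<open>g u\<close> leaves an identity between polynomials.\<close>
  also have "\<dots> = (\<Prod>u\<in>pverts H. to_fract (g u) * \<Gamma> u) * det (list_mat vs ?E)"
    using det_list_mat_scale_rows[OF vs, of "\<lambda>u. to_fract (f u)" ?E] svs f by simp
  finally have "to_fract (char_poly UG * (\<Prod>u\<in>pverts H. g u)) = to_fract ((\<Prod>u\<in>pverts H. \<phi> u) * \<Phi> f)"
    unfolding to_fract_hom.hom_mult to_fract_hom.hom_prod main
    by (simp add: prod.distrib mult_ac)
  then have polyeq: "char_poly UG * (\<Prod>u\<in>pverts H. g u) = (\<Prod>u\<in>pverts H. \<phi> u) * \<Phi> f"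
    by (simp only: to_fract_eq_iff)

  \<comment> \<open>Comparison of the root multisets, claim (ii)\<close>
  let ?R = "map_poly complex_of_real"
  have g: "g u = main_poly (U u) (c u)" for u
    by (simp add: g_def main_poly_def c_def)
  have g0: "g u \<noteq> 0" if "u \<in> pverts H" for u
    unfolding g by (rule main_poly_nonzero[OF Uc[OF that]])
  have \<phi>0: "\<phi> u \<noteq> 0" if "u \<in> pverts H" for u
    unfolding \<phi>_def by (rule char_poly_pcompose_nonzero[OF Uc[OF that]])
  have UG0: "char_poly UG \<noteq> 0" using degree_monic_char_poly[OF UGc] by auto
  \<comment> \<open>The left side of \<open>polyeq\<close> is nonzero. This matters because the
    roots of a product are the sum of the roots of the factors only for nonzero polynomials.\<close>
  have \<Phi>0: "\<Phi> f \<noteq> 0"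
    using polyeq UG0 g0 finH by auto
  let ?A = "\<lambda>u. (\<Sum>\<mu> | eigenvalue (U u) \<mu> \<and> \<not> main_eigenvalue (U u) \<mu>.
              replicate_mset (Polynomial.order \<mu> (char_poly (U u))) (complex_of_real (\<mu> + c u))) +
           (\<Sum>\<mu> | main_eigenvalue (U u) \<mu>.
              replicate_mset (Polynomial.order \<mu> (char_poly (U u)) - 1) (complex_of_real (\<mu> + c u)))"
  have \<phi>_roots: "proots (?R (\<phi> u)) = ?A u + proots (?R (g u))" if "u \<in> pverts H" for u
    unfolding \<phi>_def c_def[symmetric] proots_shifted_char_poly[OF Uc[OF that] Usym[OF that]]
      g proots_main_poly[OF Uc[OF that]] by (rule spectrum_split[OF Uc[OF that]])
  \<comment> \<open>Taking roots on both sides of \<open>polyeq\<close>, the roots of all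
    \<open>g u\<close> occur on the left explicitly and on the right inside those of
    \<open>\<phi> u\<close>, and they cancel as multisets.\<close>
  have "spectrum_mset UG + (\<Sum>u\<in>pverts H. proots (?R (g u)))
      = proots (?R (char_poly UG * (\<Prod>u\<in>pverts H. g u)))"
    unfolding spectrum_mset_def of_real_hom.char_poly_hom[OF UGc]
      of_real_poly_hom.hom_mult of_real_poly_hom.hom_prod
    using UG0 g0 finH by (simp add: proots_mult proots_prod)
  also have "\<dots> = (\<Sum>u\<in>pverts H. proots (?R (\<phi> u))) + proots (?R (\<Phi> f))"
    unfolding polyeq of_real_poly_hom.hom_mult of_real_poly_hom.hom_prod
    using \<Phi>0 \<phi>0 finH by (simp add: proots_mult proots_prod)
  also have "(\<Sum>u\<in>pverts H. proots (?R (\<phi> u)))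
      = (\<Sum>u\<in>pverts H. ?A u) + (\<Sum>u\<in>pverts H. proots (?R (g u)))"
    unfolding sum.distrib[symmetric] by (rule sum.cong[OF refl \<phi>_roots])
  finally have "spectrum_mset UG + (\<Sum>u\<in>pverts H. proots (?R (g u)))
      = ((\<Sum>u\<in>pverts H. ?A u) + proots (?R (\<Phi> f))) + (\<Sum>u\<in>pverts H. proots (?R (g u)))"
    by (simp only: add_ac)
  then have "spectrum_mset UG = (\<Sum>u\<in>pverts H. ?A u) + proots (?R (\<Phi> f))"
    by (rule add_right_imp_eq)
  then show ?thesis
    unfolding E using main f unfolding c_def by blast
qed

end
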